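(* Let $\Phi$ be a root system with Weyl group $W$ and a fixed basis of simple roots $I$, and let $(w_1,w_2)\in W^2$. Let $J\subseteq I$ be such that $\Phi_{w_1w_2^{-1}}$ is in the $W$-orbit of the root subsystem $\Phi_J\subseteq\Phi$ (such a $J$ exists). Then there exist $u^J,v^J\in W^J$ and $w_{J,1},w_{J,2}\in W_J$ such that $$w_1=u^Jw_{J,1}(v^J)^{-1},\qquad w_2=u^Jw_{J,2}(v^J)^{-1}.$$ Furthermore, for one such (equivalently, for any such) decomposition of $w_1$ and $w_2$, one has $w_{J,1}\preceq w_{J,2}$ if and only if $(w_1,w_2)$ is a good pair. Moreover, if $u^J\in W^J$ is any element with $\Phi_{w_1w_2^{-1}}=u^J(\Phi_J)$, then such a decomposition exists with this $u^J$.
   Context: $\Phi$ is a root system in a finite-dimensional $\mathbb{Q}$-vector space $E$. For $w\in W$, $E_w=\operatorname{im}(w-\mathrm{id}_E)$ and $\Phi_w=\Phi\cap E_w$ (note $\Phi_w=\Phi_{w^{-1}}$). The basis $I$ defines simple reflections, the length function and the Bruhat order $\preceq$ on $W$. For $J\subseteq I$: $\Phi_J$ is the root subsystem generated by $J$; $W_J$ is the subgroup of $W$ generated by $s_\alpha$, $\alpha\in J$; $W^J=\{w\in W: ws_\alpha\succ w\ \forall \alpha\in J\}$ is the set of minimal length representatives of $W/W_J$. Good pair: for $w_1\preceq w_2$ in $W$, $(w_1,w_2)$ is a good pair if there is a (possibly empty) sequence $(\alpha_1,\dots,\alpha_r)$ of roots in $\Phi_{w_1w_2^{-1}}$ such that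 $w_2=s_{\alpha_r}\cdots s_{\alpha_1}w_1$ and $s_{\alpha_i}\cdots s_{\alpha_1}w_1\succ s_{\alpha_{i-1}}\cdots s_{\alpha_1}w_1$ for each $1\le i\le r$; otherwise it is a bad pair. A pair with $w_1\not\preceq w_2$ is neither good nor bad. *)

theory Defs
  imports Complex_Main
begin

text \<open>
  The ambient \<open>\<rat>\<close>-vector space is a whole type with scalar multiplication \<open>scale\<close>. Root systems
  follow Bourbaki: they span, are crystallographic, and need not be reduced.
\<close>

definition is_coroot ::
  "(rat \<Rightarrow> 'v \<Rightarrow> 'v) \<Rightarrow> 'v::ab_group_add set \<Rightarrow> 'v \<Rightarrow> ('v \<Rightarrow> rat) \<Rightarrow> bool" where
  "is_coroot scale \<Phi> \<alpha> f \<longleftrightarrow>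
     Vector_Spaces.linear scale (*) f \<and> f \<alpha> = 2 \<and>
     (\<forall>\<beta>\<in>\<Phi>. \<beta> - scale (f \<beta>) \<alpha> \<in> \<Phi> \<and> f \<beta> \<in> \<int>)"

text \<open>Finite dimensionality of the space is a consequence of \<open>finite_roots\<close> and \<open>span_roots\<close>.\<close>

locale root_system = vector_space scale
  for scale :: "rat \<Rightarrow> 'v::ab_group_add \<Rightarrow> 'v" +
  fixes \<Phi> :: "'v set"
  assumes finite_roots: "finite \<Phi>"
    and zero_not_root: "0 \<notin> \<Phi>"
    and span_roots: "span \<Phi> = UNIV"
    and ex_coroot: "\<alpha> \<in> \<Phi> \<Longrightarrow> \<exists>f. is_coroot scale \<Phi> \<alpha> f"

locale based_root_system = root_system scale \<Phi>
  for scale :: "rat \<Rightarrow> 'v::ab_group_add \<Rightarrow> 'v" and \<Phi> :: "'v set" +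
  fixes I :: "'v set"
  assumes simple_roots: "I \<subseteq> \<Phi>"
    and independent_simple: "independent I"
    and span_simple: "span I = UNIV"
    and root_combination: "\<beta> \<in> \<Phi> \<Longrightarrow>
      \<exists>c :: 'v \<Rightarrow> int. \<beta> = (\<Sum>\<alpha>\<in>I. scale (of_int (c \<alpha>)) \<alpha>) \<and>
        ((\<forall>\<alpha>\<in>I. c \<alpha> \<ge> 0) \<or> (\<forall>\<alpha>\<in>I. c \<alpha> \<le> 0))"

text \<open>For a root, the coroot is unique because \<open>\<Phi>\<close> is finite and spans the space.\<close>

definition coroot :: "(rat \<Rightarrow> 'v \<Rightarrow> 'v) \<Rightarrow> 'v::ab_group_add set \<Rightarrow> 'v \<Rightarrow> 'v \<Rightarrow> rat" where
  "coroot scale \<Phi> \<alpha> = (THE f. is_coroot scale \<Phi> \<alpha> f)"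

definition reflection :: "(rat \<Rightarrow> 'v \<Rightarrow> 'v) \<Rightarrow> 'v::ab_group_add set \<Rightarrow> 'v \<Rightarrow> 'v \<Rightarrow> 'v" where
  "reflection scale \<Phi> \<alpha> v = v - scale (coroot scale \<Phi> \<alpha> v) \<alpha>"

text \<open>The subgroup of the general linear group generated by the reflections in the roots of \<open>S\<close>.\<close>

inductive_set reflection_group ::
  "(rat \<Rightarrow> 'v \<Rightarrow> 'v) \<Rightarrow> 'v::ab_group_add set \<Rightarrow> 'v set \<Rightarrow> ('v \<Rightarrow> 'v) set"
  for scale :: "rat \<Rightarrow> 'v::ab_group_add \<Rightarrow> 'v" and \<Phi> S :: "'v set" where
  one: "id \<in> reflection_group scale \<Phi> S"
| incl: "\<alpha> \<in> S \<Longrightarrow> reflection scale \<Phi> \<alpha> \<in> reflection_group scale \<Phi> S"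
| mult: "x \<in> reflection_group scale \<Phi> S \<Longrightarrow> y \<in> reflection_group scale \<Phi> S \<Longrightarrow>
    x \<circ> y \<in> reflection_group scale \<Phi> S"
| inverse: "x \<in> reflection_group scale \<Phi> S \<Longrightarrow> inv x \<in> reflection_group scale \<Phi> S"

abbreviation weyl_group ::
  "(rat \<Rightarrow> 'v \<Rightarrow> 'v) \<Rightarrow> 'v::ab_group_add set \<Rightarrow> ('v \<Rightarrow> 'v) set" where
  "weyl_group scale \<Phi> \<equiv> reflection_group scale \<Phi> \<Phi>"

text \<open>For \<open>\<alpha>s = [\<alpha>\<^sub>1, \<dots>, \<alpha>\<^sub>r]\<close> this is \<open>s\<^bsub>\<alpha>\<^sub>r\<^esub> \<cdots> s\<^bsub>\<alpha>\<^sub>1\<^esub> w\<close>: the head of the list acts first.\<close>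

definition apply_reflections ::
  "(rat \<Rightarrow> 'v \<Rightarrow> 'v) \<Rightarrow> 'v::ab_group_add set \<Rightarrow> 'v list \<Rightarrow> ('v \<Rightarrow> 'v) \<Rightarrow> 'v \<Rightarrow> 'v" where
  "apply_reflections scale \<Phi> \<alpha>s w = fold (\<lambda>\<alpha> x. reflection scale \<Phi> \<alpha> \<circ> x) \<alpha>s w"

definition weyl_length ::
  "(rat \<Rightarrow> 'v \<Rightarrow> 'v) \<Rightarrow> 'v::ab_group_add set \<Rightarrow> 'v set \<Rightarrow> ('v \<Rightarrow> 'v) \<Rightarrow> nat" where
  "weyl_length scale \<Phi> I w =
     (LEAST n. \<exists>\<alpha>s. set \<alpha>s \<subseteq> I \<and> length \<alpha>s = n \<and> apply_reflections scale \<Phi> \<alpha>s id = w)"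

text \<open>
  The Bruhat order is generated by \<open>x \<prec> s\<^bsub>\<alpha>\<^esub> x\<close> for arbitrary roots \<open>\<alpha>\<close> with
  \<open>\<ell>(x) < \<ell>(s\<^bsub>\<alpha>\<^esub> x)\<close>.
\<close>

definition bruhat_step ::
  "(rat \<Rightarrow> 'v \<Rightarrow> 'v) \<Rightarrow> 'v::ab_group_add set \<Rightarrow> 'v set \<Rightarrow> ('v \<Rightarrow> 'v) \<Rightarrow> ('v \<Rightarrow> 'v) \<Rightarrow> bool" where
  "bruhat_step scale \<Phi> I x y \<longleftrightarrow>
     (\<exists>\<alpha>\<in>\<Phi>. y = reflection scale \<Phi> \<alpha> \<circ> x) \<and> weyl_length scale \<Phi> I x < weyl_length scale \<Phi> I y"

definition bruhat_le ::
  "(rat \<Rightarrow> 'v \<Rightarrow> 'v) \<Rightarrow> 'v::ab_group_add set \<Rightarrow> 'v set \<Rightarrow> ('v \<Rightarrow> 'v) \<Rightarrow> ('v \<Rightarrow> 'v) \<Rightarrow> bool" where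
  "bruhat_le scale \<Phi> I x y \<longleftrightarrow>
     x \<in> weyl_group scale \<Phi> \<and> y \<in> weyl_group scale \<Phi> \<and> (bruhat_step scale \<Phi> I)\<^sup>*\<^sup>* x y"

definition bruhat_less ::
  "(rat \<Rightarrow> 'v \<Rightarrow> 'v) \<Rightarrow> 'v::ab_group_add set \<Rightarrow> 'v set \<Rightarrow> ('v \<Rightarrow> 'v) \<Rightarrow> ('v \<Rightarrow> 'v) \<Rightarrow> bool" where
  "bruhat_less scale \<Phi> I x y \<longleftrightarrow> bruhat_le scale \<Phi> I x y \<and> x \<noteq> y"

text \<open>\<open>\<Phi>\<^sub>J\<close>: as \<open>J\<close> consists of simple roots, the rational and the integral span give the same set.\<close>

definition root_subsystem :: "(rat \<Rightarrow> 'v \<Rightarrow> 'v) \<Rightarrow> 'v::ab_group_add set \<Rightarrow> 'v set \<Rightarrow> 'v set" where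
  "root_subsystem scale \<Phi> J = \<Phi> \<inter> module.span scale J"

definition min_coset_reps ::
  "(rat \<Rightarrow> 'v \<Rightarrow> 'v) \<Rightarrow> 'v::ab_group_add set \<Rightarrow> 'v set \<Rightarrow> 'v set \<Rightarrow> ('v \<Rightarrow> 'v) set" where
  "min_coset_reps scale \<Phi> I J =
     {w \<in> weyl_group scale \<Phi>. \<forall>\<alpha>\<in>J. bruhat_less scale \<Phi> I w (w \<circ> reflection scale \<Phi> \<alpha>)}"

definition moved_space :: "('v::ab_group_add \<Rightarrow> 'v) \<Rightarrow> 'v set" where
  "moved_space w = range (\<lambda>v. w v - v)"

definition roots_of :: "'v::ab_group_add set \<Rightarrow> ('v \<Rightarrow> 'v) \<Rightarrow> 'v set" where
  "roots_of \<Phi> w = \<Phi> \<inter> moved_space w"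

definition good_pair ::
  "(rat \<Rightarrow> 'v \<Rightarrow> 'v) \<Rightarrow> 'v::ab_group_add set \<Rightarrow> 'v set \<Rightarrow> ('v \<Rightarrow> 'v) \<Rightarrow> ('v \<Rightarrow> 'v) \<Rightarrow> bool" where
  "good_pair scale \<Phi> I w1 w2 \<longleftrightarrow>
     bruhat_le scale \<Phi> I w1 w2 \<and>
     (\<exists>\<alpha>s. set \<alpha>s \<subseteq> roots_of \<Phi> (w1 \<circ> inv w2) \<and>
       w2 = apply_reflections scale \<Phi> \<alpha>s w1 \<and>
       (\<forall>i<length \<alpha>s. bruhat_less scale \<Phi> I
          (apply_reflections scale \<Phi> (take i \<alpha>s) w1)
          (apply_reflections scale \<Phi> (take (Suc i) \<alpha>s) w1)))"

end

(*
  The moved space of w is the orthogonal complement of its fixed space for a W-invariant form, so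
  the roots of w are those orthogonal to a generic fixed vector p. Conjugating p into the dominant
  chamber turns its stabiliser into a standard parabolic subgroup W_J; hence w1 w2^-1 lies in
  u W_J u^-1, which gives the decomposition.

  The comparison rests on the rule l(x) < l(x s_d) iff x d > 0, for d > 0. An element of W^J keeps
  the sign of roots of Phi_J, so y -> u y v^-1 identifies the length-increasing reflections of W_J
  with those in u(Phi_J) between the translated elements. Since W_J permutes the positive roots
  outside Phi_J, a Bruhat chain in W ending in W_J uses only roots of Phi_J.
*)

theory Submission
  imports Defs
begin

text \<open>The space carries no inner product, so the invariant form is manufactured by averaging
  over \<open>W\<close>. This needs \<open>W\<close> to be finite, which is why uniqueness of
  coroots and the action on \<Phi> precede all geometry. As \<Phi> need not be reduced, a proper
  multiple of a simple root may be a root, and arguments that usually identify two roots identify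
  only their reflections. Bruhat steps multiply on the left, whereas the length rule concerns the
  right; each step at x is therefore rewritten with the root x^-1 \<alpha>, up to sign. No formula
  for the length of u y v^-1 enters, only signs of roots. The set J of the theorem is prescribed and
  may differ from the one that a generic fixed vector produces, so two descriptions of the same set
  of roots must be compared. For an arbitrary decomposition the roots of w1 w2^-1 are at first only
  known to lie in u(\<Phi>_J); counting gives equality.\<close>

lemma reflection_group_mono:
  "S \<subseteq> T \<Longrightarrow> reflection_group scale \<Phi> S \<subseteq> reflection_group scale \<Phi> T"
proof
  fix x assume "S \<subseteq> T" "x \<in> reflection_group scale \<Phi> S"
  from this(2,1) show "x \<in> reflection_group scale \<Phi> T"
    by induction (auto intro: reflection_group.intros)
qed

section \<open>Words in reflections\<close>

lemma apply_reflections_Nil [simp]: "apply_reflections scale \<Phi> [] w = w"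
  by (simp add: apply_reflections_def)

lemma apply_reflections_snoc [simp]:
  "apply_reflections scale \<Phi> (\<alpha>s @ [\<alpha>]) w = reflection scale \<Phi> \<alpha> \<circ> apply_reflections scale \<Phi> \<alpha>s w"
  by (simp add: apply_reflections_def)

lemma apply_reflections_append:
  "apply_reflections scale \<Phi> (\<alpha>s @ \<beta>s) w = apply_reflections scale \<Phi> \<beta>s (apply_reflections scale \<Phi> \<alpha>s w)"
  by (simp add: apply_reflections_def)

lemma apply_reflections_comp:
  "apply_reflections scale \<Phi> \<alpha>s (x \<circ> y) = apply_reflections scale \<Phi> \<alpha>s x \<circ> y"
  by (induction \<alpha>s rule: rev_induct) (simp_all add: comp_assoc)

lemma apply_reflections_in_group:
  "set \<alpha>s \<subseteq> S \<Longrightarrow> apply_reflections scale \<Phi> \<alpha>s id \<in> reflection_group scale \<Phi> S"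
  by (induction \<alpha>s rule: rev_induct) (auto intro: reflection_group.intros)

subsection \<open>Reflections and the Weyl group\<close>

context root_system
begin

abbreviation refl ("s") where "refl \<equiv> reflection scale \<Phi>"
abbreviation W where "W \<equiv> weyl_group scale \<Phi>"

lemma linear_self_iff:
  "Vector_Spaces.linear scale scale f \<longleftrightarrow>
     (\<forall>x y. f (x + y) = f x + f y) \<and> (\<forall>c x. f (scale c x) = scale c (f x))"
  by (simp add: Vector_Spaces.linear_iff vector_space_axioms)

lemma linear_form_iff:
  "Vector_Spaces.linear scale (*) f \<longleftrightarrow>
     (\<forall>x y. f (x + y) = f x + f y) \<and> (\<forall>c x. f (scale c x) = c * f x)"
proof -
  have "vector_space ((*) :: rat \<Rightarrow> rat \<Rightarrow> rat)"
    by unfold_locales (simp_all add: algebra_simps)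
  then show ?thesis by (simp add: Vector_Spaces.linear_iff vector_space_axioms)
qed

lemma linear_form_diff: "Vector_Spaces.linear scale (*) f \<Longrightarrow> f (x - y) = f x - f y"
  unfolding linear_form_iff by (metis add_diff_cancel_right' diff_add_cancel)

text \<open>The product of the reflections attached to two coroots of \<open>\<alpha>\<close> is unipotent, so its orbits
  on the finite set of roots would be infinite unless it is trivial.\<close>

lemma coroot_unique:
  assumes f: "is_coroot scale \<Phi> \<alpha> f" and g: "is_coroot scale \<Phi> \<alpha> g" and "\<alpha> \<in> \<Phi>"
  shows "f = g"
proof -
  have lf: "Vector_Spaces.linear scale (*) f" and lg: "Vector_Spaces.linear scale (*) g"
    and f2: "f \<alpha> = 2" and g2: "g \<alpha> = 2" using f g by (auto simp: is_coroot_def)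
  have on_roots: "f \<beta> = g \<beta>" if "\<beta> \<in> \<Phi>" for \<beta>
  proof (rule ccontr)
    assume ne: "f \<beta> \<noteq> g \<beta>"
    define d where "d = g \<beta> - f \<beta>"
    have d: "d \<noteq> 0" using ne by (simp add: d_def)
    have orbit: "\<beta> + scale (of_nat n * d) \<alpha> \<in> \<Phi>" for n
    proof (induction n)
      case (Suc n)
      define x where "x = \<beta> + scale (of_nat n * d) \<alpha>"
      define y where "y = x - scale (g x) \<alpha>"
      have "x \<in> \<Phi>" using Suc by (simp add: x_def)
      then have "y \<in> \<Phi>" using g by (auto simp: is_coroot_def y_def)
      then have fy: "y - scale (f y) \<alpha> \<in> \<Phi>" using f by (auto simp: is_coroot_def)
      have fy2: "f y = f x - 2 * g x"
        using lf f2 by (simp add: y_def linear_form_diff linear_form_iff)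
      \<comment> \<open>Both forms take the value 2 at \<open>\<alpha>\<close>, so
        \<open>g - f\<close> vanishes there and the translation by \<open>d\<close> is the same at
        every point of the orbit.\<close>
      have gf: "g x - f x = d"
        using lf lg f2 g2 by (simp add: x_def linear_form_iff d_def)
      have "f y = - f x - 2 * d" and gx: "g x = f x + d" using fy2 gf by auto
      then have "y - scale (f y) \<alpha> = x - scale (f x + d) \<alpha> - scale (- f x - 2 * d) \<alpha>"
        by (simp add: y_def gx)
      also have "\<dots> = x + scale d \<alpha>"
        unfolding diff_conv_add_uminus scale_minus_left[symmetric] add.assoc scale_left_distrib[symmetric]
        by simp
      finally have "x + scale d \<alpha> \<in> \<Phi>" using fy by simp
      moreover have "x + scale d \<alpha> = \<beta> + scale (of_nat (Suc n) * d) \<alpha>"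
        by (simp add: x_def scale_left_distrib algebra_simps)
      ultimately show ?case by simp
    qed (use that in simp)
    have "\<alpha> \<noteq> 0" using \<open>\<alpha> \<in> \<Phi>\<close> zero_not_root by auto
    then have "inj (\<lambda>n::nat. \<beta> + scale (of_nat n * d) \<alpha>)"
      using d by (auto simp: inj_def)
    moreover have "finite (range (\<lambda>n::nat. \<beta> + scale (of_nat n * d) \<alpha>))"
      using finite_roots orbit by (auto intro: finite_subset)
    ultimately show False using finite_imageD by blast
  qed
  have "f v = g v" for v
  proof -
    have "v \<in> span \<Phi>" using span_roots by simp
    then show ?thesis
    proof (induction v rule: span_induct)
      case base
      show ?case using lf lg unfolding subspace_def linear_form_iff
        by auto (metis mult_zero_left scale_zero_left)
    qed (rule on_roots)
  qed
  then show ?thesis by blast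
qed

lemma coroot: "\<alpha> \<in> \<Phi> \<Longrightarrow> is_coroot scale \<Phi> \<alpha> (coroot scale \<Phi> \<alpha>)"
  unfolding coroot_def by (metis coroot_unique ex_coroot theI)

lemma refl_linear: "\<alpha> \<in> \<Phi> \<Longrightarrow> Vector_Spaces.linear scale scale (s \<alpha>)"
  using coroot[of \<alpha>] unfolding linear_self_iff is_coroot_def linear_form_iff reflection_def
  by (simp add: algebra_simps)

lemma refl_root: "\<alpha> \<in> \<Phi> \<Longrightarrow> \<beta> \<in> \<Phi> \<Longrightarrow> s \<alpha> \<beta> \<in> \<Phi>"
  using coroot[of \<alpha>] by (auto simp: is_coroot_def reflection_def)

lemma refl_self [simp]: "\<alpha> \<in> \<Phi> \<Longrightarrow> s \<alpha> \<alpha> = - \<alpha>"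
  using coroot[of \<alpha>] scale_left_distrib[of 1 1 \<alpha>] by (simp add: is_coroot_def reflection_def)

lemma refl_refl [simp]: "\<alpha> \<in> \<Phi> \<Longrightarrow> s \<alpha> (s \<alpha> v) = v"
proof -
  assume a: "\<alpha> \<in> \<Phi>"
  have "coroot scale \<Phi> \<alpha> (s \<alpha> v) = - coroot scale \<Phi> \<alpha> v"
    using coroot[OF a] by (auto simp: is_coroot_def reflection_def linear_form_diff linear_form_iff)
  then show ?thesis by (simp add: reflection_def)
qed

lemma refl_comp_refl [simp]: "\<alpha> \<in> \<Phi> \<Longrightarrow> s \<alpha> \<circ> s \<alpha> = id"
  by (simp add: fun_eq_iff)

lemma refl_bij: "\<alpha> \<in> \<Phi> \<Longrightarrow> bij (s \<alpha>)"
  by (rule o_bij[of "s \<alpha>"]) simp_all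

lemma root_uminus: "\<alpha> \<in> \<Phi> \<Longrightarrow> - \<alpha> \<in> \<Phi>"
  using refl_root[of \<alpha> \<alpha>] by simp

text \<open>The three properties go through one induction because the case of \<open>inv x\<close>
  needs bijectivity of \<open>x\<close> to transfer linearity and the action on roots.\<close>

lemma W_linear_bij: "w \<in> W \<Longrightarrow> Vector_Spaces.linear scale scale w \<and> bij w \<and> w ` \<Phi> = \<Phi>"
proof (induction rule: reflection_group.induct)
  case one
  have "Vector_Spaces.linear scale scale id \<and> bij id \<and> id ` \<Phi> = \<Phi>"
    by (simp add: linear_self_iff)
  then show ?case .
next
  case (incl \<alpha>)
  have "\<beta> \<in> s \<alpha> ` \<Phi>" if "\<beta> \<in> \<Phi>" for \<beta>
    by (rule image_eqI[of _ _ "s \<alpha> \<beta>"]) (use incl that in \<open>auto intro: refl_root\<close>)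
  then show ?case using incl by (auto intro: refl_linear refl_bij refl_root)
next
  case (mult x y)
  then have "(x \<circ> y) ` \<Phi> = \<Phi>" by (metis image_comp)
  with mult have "Vector_Spaces.linear scale scale (x \<circ> y) \<and> bij (x \<circ> y) \<and> (x \<circ> y) ` \<Phi> = \<Phi>"
    by (simp add: linear_self_iff bij_comp)
  then show ?case .
next
  case (inverse x)
  then have bx: "bij x" and lx: "Vector_Spaces.linear scale scale x" and im: "x ` \<Phi> = \<Phi>" by auto
  have "Vector_Spaces.linear scale scale (inv x)"
    using lx bx unfolding linear_self_iff by (metis bij_inv_eq_iff)
  moreover have "inv x ` \<Phi> = \<Phi>"
    using bx im by (metis bij_is_inj image_inv_f_f)
  ultimately show ?case using bx by (simp add: bij_imp_bij_inv)
qed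

lemma W_bij: "w \<in> W \<Longrightarrow> bij w"
  and W_image_roots: "w \<in> W \<Longrightarrow> w ` \<Phi> = \<Phi>"
  and W_linear: "w \<in> W \<Longrightarrow> Vector_Spaces.linear scale scale w"
  using W_linear_bij by auto

lemma W_add: "w \<in> W \<Longrightarrow> w (x + y) = w x + w y"
  and W_scale: "w \<in> W \<Longrightarrow> w (scale c x) = scale c (w x)"
  using W_linear by (auto simp: linear_self_iff)

lemma W_zero: "w \<in> W \<Longrightarrow> w 0 = 0"
  using W_scale[of w 0 0] by simp

lemma W_uminus: "w \<in> W \<Longrightarrow> w (- x) = - w x"
  using W_scale[of w "-1" x] by simp

lemma W_diff: "w \<in> W \<Longrightarrow> w (x - y) = w x - w y"
  using W_add[of w x "- y"] by (simp add: W_uminus)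

lemma W_sum: "w \<in> W \<Longrightarrow> w (sum f A) = (\<Sum>a\<in>A. w (f a))"
  by (induction A rule: infinite_finite_induct) (simp_all add: W_zero W_add)

lemma W_root: "w \<in> W \<Longrightarrow> \<beta> \<in> \<Phi> \<Longrightarrow> w \<beta> \<in> \<Phi>"
  using W_image_roots by blast

lemma W_inv_apply [simp]: "w \<in> W \<Longrightarrow> inv w (w x) = x" "w \<in> W \<Longrightarrow> w (inv w x) = x"
  using W_bij by (auto simp: bij_is_inj bij_is_surj surj_f_inv_f)

lemma W_inv_comp [simp]: "w \<in> W \<Longrightarrow> inv w \<circ> w = id" "w \<in> W \<Longrightarrow> w \<circ> inv w = id"
  by (auto simp: fun_eq_iff)

lemma W_inv_inv: "w \<in> W \<Longrightarrow> inv (inv w) = w"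
  using W_bij by (simp add: inv_inv_eq)

lemma W_inv_of_comp: "x \<in> W \<Longrightarrow> y \<in> W \<Longrightarrow> inv (x \<circ> y) = inv y \<circ> inv x"
  using W_bij by (simp add: o_inv_distrib)

lemma W_eqI: "x \<in> W \<Longrightarrow> y \<in> W \<Longrightarrow> (\<And>\<beta>. \<beta> \<in> \<Phi> \<Longrightarrow> x \<beta> = y \<beta>) \<Longrightarrow> x = y"
proof
  fix v assume W: "x \<in> W" "y \<in> W" and eq: "\<And>\<beta>. \<beta> \<in> \<Phi> \<Longrightarrow> x \<beta> = y \<beta>"
  have "v \<in> span \<Phi>" using span_roots by simp
  then show "x v = y v"
  proof (induction v rule: span_induct)
    case base
    show ?case using W by (auto simp: subspace_def W_zero W_add W_scale)
  qed (rule eq)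
qed

text \<open>An element of \<open>W\<close> is determined by its values on the finite spanning set
  \<Phi>. The default value 0 off \<Phi> makes the restriction a total function, so that all
  restrictions lie in a finite set of functions.\<close>

lemma finite_W: "finite W"
proof (rule finite_imageD)
  show "inj_on (\<lambda>w \<beta>. if \<beta> \<in> \<Phi> then w \<beta> else 0) W"
    by (rule inj_onI, rule W_eqI) (auto simp: fun_eq_iff split: if_splits)
  have "(\<lambda>w \<beta>. if \<beta> \<in> \<Phi> then w \<beta> else 0) ` W \<subseteq>
      {f. (\<forall>\<beta>. \<beta> \<in> \<Phi> \<longrightarrow> f \<beta> \<in> \<Phi>) \<and> (\<forall>\<beta>. \<beta> \<notin> \<Phi> \<longrightarrow> f \<beta> = 0)}"
    by (auto intro: W_root)
  moreover have "finite {f. (\<forall>\<beta>. (\<beta> \<in> \<Phi> \<longrightarrow> f \<beta> \<in> \<Phi>) \<and> (\<beta> \<notin> \<Phi> \<longrightarrow> f \<beta> = 0))}"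
    by (rule finite_set_of_finite_funs[OF finite_roots finite_roots])
  ultimately show "finite ((\<lambda>w \<beta>. if \<beta> \<in> \<Phi> then w \<beta> else 0) ` W)"
    by (auto elim!: finite_subset[rotated])
qed

lemma refl_W [simp]: "\<alpha> \<in> \<Phi> \<Longrightarrow> s \<alpha> \<in> W"
  and comp_W [simp]: "x \<in> W \<Longrightarrow> y \<in> W \<Longrightarrow> x \<circ> y \<in> W"
  and inv_W [simp]: "x \<in> W \<Longrightarrow> inv x \<in> W"
  and id_W [simp]: "id \<in> W"
  by (auto intro: reflection_group.intros)

end

subsection \<open>Positive roots and the invariant form\<close>

context based_root_system
begin

abbreviation coeff :: "'v \<Rightarrow> 'v \<Rightarrow> rat" where "coeff \<equiv> representation I"

text \<open>Being a root is part of positivity, so \<open>\<not> pos\<close> means "negative" only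
  for vectors already known to be roots.\<close>

definition pos :: "'v \<Rightarrow> bool" where
  "pos \<beta> \<longleftrightarrow> \<beta> \<in> \<Phi> \<and> (\<forall>\<alpha>. 0 \<le> coeff \<beta> \<alpha>)"

lemma finite_simple: "finite I"
  using simple_roots finite_roots finite_subset by blast

lemma coeff_add: "coeff (x + y) \<alpha> = coeff x \<alpha> + coeff y \<alpha>"
  and coeff_scale: "coeff (scale c x) \<alpha> = c * coeff x \<alpha>"
  using independent_simple span_simple by (simp_all add: representation_add representation_scale)

lemma coeff_uminus: "coeff (- x) \<alpha> = - coeff x \<alpha>"
  using coeff_scale[of "-1" x] by simp

lemma coeff_diff: "coeff (x - y) \<alpha> = coeff x \<alpha> - coeff y \<alpha>"
  using coeff_add[of x "- y"] by (simp add: coeff_uminus)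

lemma coeff_zero: "coeff 0 \<alpha> = 0"
  using coeff_scale[of 0 0] by simp

lemma coeff_simple: "\<alpha> \<in> I \<Longrightarrow> coeff \<alpha> \<beta> = (if \<beta> = \<alpha> then 1 else 0)"
  using independent_simple by (simp add: representation_basis)

lemma coeff_outside: "\<alpha> \<notin> I \<Longrightarrow> coeff x \<alpha> = 0"
  using representation_ne_zero by blast

lemma sum_coeff: "(\<Sum>\<alpha>\<in>I. scale (coeff x \<alpha>) \<alpha>) = x"
  using independent_simple span_simple finite_simple by (intro sum_representation_eq) auto

lemma coeff_eqI: "(\<And>\<alpha>. coeff x \<alpha> = coeff y \<alpha>) \<Longrightarrow> x = y"
  by (metis (no_types, lifting) sum.cong sum_coeff)

lemma coeff_sum: "coeff (sum f A) \<alpha> = (\<Sum>a\<in>A. coeff (f a) \<alpha>)"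
  by (induction A rule: infinite_finite_induct) (simp_all add: coeff_add coeff_zero)

text \<open>Membership in \<Phi>_J becomes a condition on coordinates outside \<open>J\<close>,
  exactly those that the parabolic subgroup leaves unchanged.\<close>

lemma span_subset_simple_iff:
  assumes "J \<subseteq> I"
  shows "x \<in> span J \<longleftrightarrow> (\<forall>\<delta>. \<delta> \<notin> J \<longrightarrow> coeff x \<delta> = 0)"
proof
  assume "x \<in> span J"
  then show "\<forall>\<delta>. \<delta> \<notin> J \<longrightarrow> coeff x \<delta> = 0"
  proof (induction x rule: span_induct)
    case (step x)
    then show ?case using assms by (auto simp: coeff_simple)
  qed (auto simp: subspace_def coeff_zero coeff_add coeff_scale)
next
  assume *: "\<forall>\<delta>. \<delta> \<notin> J \<longrightarrow> coeff x \<delta> = 0"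
  have "scale (coeff x \<alpha>) \<alpha> \<in> span J" for \<alpha>
    by (cases "\<alpha> \<in> J") (auto simp: * span_base span_scale span_zero)
  then have "(\<Sum>\<alpha>\<in>I. scale (coeff x \<alpha>) \<alpha>) \<in> span J" by (intro span_sum)
  then show "x \<in> span J" by (simp add: sum_coeff)
qed

lemma root_coeff_cases:
  assumes "\<beta> \<in> \<Phi>"
  shows "(\<forall>\<alpha>. 0 \<le> coeff \<beta> \<alpha>) \<or> (\<forall>\<alpha>. coeff \<beta> \<alpha> \<le> 0)"
proof -
  from root_combination[OF assms] obtain c :: "'v \<Rightarrow> int" where
    c: "\<beta> = (\<Sum>\<alpha>\<in>I. scale (of_int (c \<alpha>)) \<alpha>)" and
    sgn: "(\<forall>\<alpha>\<in>I. c \<alpha> \<ge> 0) \<or> (\<forall>\<alpha>\<in>I. c \<alpha> \<le> 0)" by blast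
  have "coeff \<beta> \<alpha> = (if \<alpha> \<in> I then of_int (c \<alpha>) else 0)" for \<alpha>
  proof -
    have "coeff \<beta> \<alpha> = (\<Sum>\<gamma>\<in>I. if \<gamma> = \<alpha> then of_int (c \<gamma>) else 0)"
      unfolding c coeff_sum by (rule sum.cong) (auto simp: coeff_scale coeff_simple)
    then show ?thesis using finite_simple by simp
  qed
  with sgn show ?thesis by auto
qed

lemma pos_root: "pos \<beta> \<Longrightarrow> \<beta> \<in> \<Phi>"
  by (simp add: pos_def)

lemma not_pos_iff:
  assumes "\<beta> \<in> \<Phi>"
  shows "\<not> pos \<beta> \<longleftrightarrow> pos (- \<beta>)"
proof -
  have "pos \<beta> \<or> pos (- \<beta>)"
    using root_coeff_cases[OF assms] assms by (auto simp: pos_def coeff_uminus root_uminus)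
  moreover have False if "pos \<beta>" "pos (- \<beta>)"
  proof -
    have "coeff \<beta> \<alpha> = coeff 0 \<alpha>" for \<alpha>
      using that by (auto simp: pos_def coeff_uminus coeff_zero order_eq_iff)
    then have "\<beta> = 0" by (rule coeff_eqI)
    then show False using assms zero_not_root by auto
  qed
  ultimately show ?thesis by auto
qed

text \<open>The coordinates of a root never have mixed signs, so one of them settles the sign; this
  serves arguments that control a single coordinate.\<close>

lemma pos_if_coeff_pos: "\<beta> \<in> \<Phi> \<Longrightarrow> 0 < coeff \<beta> \<delta> \<Longrightarrow> pos \<beta>"
  using root_coeff_cases[of \<beta>] by (auto simp: pos_def simp flip: not_less)

lemma pos_simple: "\<alpha> \<in> I \<Longrightarrow> pos \<alpha>"
  using simple_roots by (auto simp: pos_def coeff_simple)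

text \<open>The dot product for which \<open>I\<close> is orthonormal, summed over the finite group:
  summation gives invariance, and on the diagonal every term is a square.\<close>

definition form :: "'v \<Rightarrow> 'v \<Rightarrow> rat" where
  "form x y = (\<Sum>w\<in>W. \<Sum>\<alpha>\<in>I. coeff (w x) \<alpha> * coeff (w y) \<alpha>)"

lemma form_commute: "form x y = form y x"
  by (simp add: form_def mult.commute)

lemma form_add_left: "form (x + y) z = form x z + form y z"
  by (simp add: form_def W_add coeff_add distrib_right sum.distrib)

lemma form_scale_left: "form (scale c x) z = c * form x z"
  by (simp add: form_def W_scale coeff_scale sum_distrib_left mult.assoc)

lemma form_uminus_left: "form (- x) z = - form x z"
  using form_scale_left[of "-1" x] by simp

lemma form_diff_left: "form (x - y) z = form x z - form y z"
  using form_add_left[of x "- y"] by (simp add: form_uminus_left)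

lemma form_add_right: "form z (x + y) = form z x + form z y"
  and form_scale_right: "form z (scale c x) = c * form z x"
  and form_uminus_right: "form z (- x) = - form z x"
  using form_add_left form_scale_left form_uminus_left
  by (simp_all add: form_commute[of z])

lemma form_sum_left: "form (sum f A) z = (\<Sum>a\<in>A. form (f a) z)"
  by (induction A rule: infinite_finite_induct)
     (use form_scale_left[of 0] in \<open>simp_all add: form_add_left\<close>)

lemma form_eq_sum_coeff: "form x y = (\<Sum>\<alpha>\<in>I. coeff x \<alpha> * form \<alpha> y)"
  using form_sum_left[of "\<lambda>\<alpha>. scale (coeff x \<alpha>) \<alpha>" I y] by (simp add: sum_coeff form_scale_left)

lemma form_eq_zero_iff: "form x x = 0 \<longleftrightarrow> x = 0"
proof
  assume "form x x = 0"
  then have "\<forall>w\<in>W. (\<Sum>\<alpha>\<in>I. coeff (w x) \<alpha> * coeff (w x) \<alpha>) = 0"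
    unfolding form_def using finite_W by (subst (asm) sum_nonneg_eq_0_iff) (auto intro: sum_nonneg)
  \<comment> \<open>The summand of the identity alone forces all coordinates of \<open>x\<close> to
    vanish.\<close>
  from this[rule_format, OF id_W] have "\<forall>\<alpha>\<in>I. coeff x \<alpha> = 0"
    using finite_simple by (subst (asm) sum_nonneg_eq_0_iff) auto
  then show "x = 0" by (intro coeff_eqI) (metis coeff_outside coeff_zero)
qed (use form_scale_left[of 0 x x] in simp)

lemma form_pos: "x \<noteq> 0 \<Longrightarrow> 0 < form x x"
proof -
  assume "x \<noteq> 0"
  moreover have "0 \<le> form x x" by (auto simp: form_def intro!: sum_nonneg)
  ultimately show ?thesis using form_eq_zero_iff[of x] by simp
qed

lemma form_W: "u \<in> W \<Longrightarrow> form (u x) (u y) = form x y"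
  unfolding form_def
  by (rule sum.reindex_bij_witness[of _ "\<lambda>w. w \<circ> inv u" "\<lambda>w. w \<circ> u"]) (auto simp: comp_assoc)

lemma form_root_pos: "\<alpha> \<in> \<Phi> \<Longrightarrow> 0 < form \<alpha> \<alpha>"
  using form_pos[of \<alpha>] zero_not_root by auto

text \<open>Invariance under \<open>s \<alpha>\<close>, which negates \<open>\<alpha>\<close>, is a
  linear equation for the value of the coroot at \<open>x\<close>; positivity of
  \<open>form \<alpha> \<alpha>\<close> allows solving it.\<close>

lemma coroot_eq:
  assumes "\<alpha> \<in> \<Phi>"
  shows "coroot scale \<Phi> \<alpha> x = 2 * form x \<alpha> / form \<alpha> \<alpha>"
proof -
  have "form x \<alpha> = form (s \<alpha> x) (s \<alpha> \<alpha>)" using assms by (simp add: form_W del: refl_self)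
  also have "\<dots> = - form x \<alpha> + coroot scale \<Phi> \<alpha> x * form \<alpha> \<alpha>"
    using assms by (simp add: reflection_def[of _ _ _ x] form_uminus_right form_diff_left form_scale_left)
  finally show ?thesis using form_root_pos[OF assms] by (simp add: field_simps)
qed

lemma refl_eq: "\<alpha> \<in> \<Phi> \<Longrightarrow> s \<alpha> x = x - scale (2 * form x \<alpha> / form \<alpha> \<alpha>) \<alpha>"
  by (simp add: reflection_def coroot_eq)

text \<open>Needed because proportional roots other than \<plusminus>\<open>\<alpha>\<close> can
  occur in a non-reduced system.\<close>

lemma refl_scaled:
  assumes "\<alpha> \<in> \<Phi>" "scale c \<alpha> \<in> \<Phi>"
  shows "s (scale c \<alpha>) = s \<alpha>"
proof -
  have "c \<noteq> 0" using assms zero_not_root by auto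
  then show ?thesis
    using assms by (simp add: fun_eq_iff refl_eq form_scale_left form_scale_right)
qed

lemma refl_uminus: "\<alpha> \<in> \<Phi> \<Longrightarrow> s (- \<alpha>) = s \<alpha>"
  using refl_scaled[of \<alpha> "-1"] by (simp add: root_uminus)

lemma refl_image_comp: "w \<in> W \<Longrightarrow> \<alpha> \<in> \<Phi> \<Longrightarrow> s (w \<alpha>) \<circ> w = w \<circ> s \<alpha>"
  by (simp add: fun_eq_iff refl_eq W_root form_W W_diff W_scale)

lemma coeff_refl: "\<alpha> \<in> I \<Longrightarrow> \<delta> \<noteq> \<alpha> \<Longrightarrow> coeff (s \<alpha> x) \<delta> = coeff x \<delta>"
  by (simp add: reflection_def coeff_diff coeff_scale coeff_simple)

text \<open>\<open>s \<alpha>\<close> alters only the coordinate at \<open>\<alpha>\<close>. Any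
  other nonzero coordinate of \<open>\<beta>\<close> would survive and keep the image positive, so
  \<open>\<beta>\<close> is a multiple of \<open>\<alpha>\<close>.\<close>

lemma refl_eq_simple_refl:
  assumes \<alpha>: "\<alpha> \<in> I" and \<beta>: "pos \<beta>" and neg: "\<not> pos (s \<alpha> \<beta>)"
  shows "s \<beta> = s \<alpha>"
proof -
  have in\<Phi>: "\<alpha> \<in> \<Phi>" "\<beta> \<in> \<Phi>" using \<alpha> \<beta> simple_roots pos_root by auto
  have "coeff \<beta> \<delta> = 0" if "\<delta> \<noteq> \<alpha>" for \<delta>
  proof (rule ccontr)
    assume "coeff \<beta> \<delta> \<noteq> 0"
    then have "0 < coeff (s \<alpha> \<beta>) \<delta>"
      using \<beta> coeff_refl[OF \<alpha> that, of \<beta>] by (simp add: pos_def order_less_le)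
    then show False using neg pos_if_coeff_pos refl_root[OF in\<Phi>] by blast
  qed
  then have "\<beta> = scale (coeff \<beta> \<alpha>) \<alpha>"
    using \<alpha> by (intro coeff_eqI) (auto simp: coeff_scale coeff_simple)
  then show ?thesis using refl_scaled[of \<alpha> "coeff \<beta> \<alpha>"] in\<Phi> by simp
qed

section \<open>Standard parabolic subgroups\<close>

lemma parabolic_subset: "J \<subseteq> I \<Longrightarrow> reflection_group scale \<Phi> J \<subseteq> W"
  using reflection_group_mono[of J \<Phi>] simple_roots by blast

lemma coeff_parabolic:
  assumes "J \<subseteq> I" "y \<in> reflection_group scale \<Phi> J" "\<delta> \<notin> J"
  shows "coeff (y x) \<delta> = coeff x \<delta>"
  using assms(2)
proof (induction arbitrary: x rule: reflection_group.induct)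
  case (incl \<alpha>)
  then show ?case using assms by (intro coeff_refl) auto
next
  case (inverse y)
  then show ?case using parabolic_subset[OF assms(1)] by (metis W_inv_apply(2) subsetD)
qed simp_all

text \<open>Such a root has a positive coordinate outside \<open>J\<close>; the parabolic subgroup
  keeps this coordinate, and it decides the sign of the image.\<close>

lemma pos_parabolic:
  assumes "J \<subseteq> I" "y \<in> reflection_group scale \<Phi> J" "pos \<beta>" "\<beta> \<notin> span J"
  shows "pos (y \<beta>)"
proof -
  obtain \<delta> where "\<delta> \<notin> J" "coeff \<beta> \<delta> \<noteq> 0" using assms by (auto simp: span_subset_simple_iff)
  then have "0 < coeff (y \<beta>) \<delta>" using assms by (simp add: coeff_parabolic pos_def order_less_le)
  moreover have "y \<beta> \<in> \<Phi>" using assms parabolic_subset W_root pos_root by blast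
  ultimately show ?thesis using pos_if_coeff_pos by blast
qed

lemma span_parabolic:
  "J \<subseteq> I \<Longrightarrow> y \<in> reflection_group scale \<Phi> J \<Longrightarrow> y x \<in> span J \<longleftrightarrow> x \<in> span J"
  by (simp add: span_subset_simple_iff coeff_parabolic)

definition height :: "'v \<Rightarrow> rat" where
  "height x = (\<Sum>\<alpha>\<in>I. coeff x \<alpha>)"

lemma height_refl:
  assumes "\<alpha> \<in> I"
  shows "height (s \<alpha> x) = height x - coroot scale \<Phi> \<alpha> x"
proof -
  have "height \<alpha> = 1" using assms finite_simple by (simp add: height_def coeff_simple)
  then show ?thesis
    by (simp add: height_def reflection_def coeff_diff coeff_scale sum_subtractf flip: sum_distrib_left)
qed

text \<open>Among the positive images of \<open>\<gamma>\<close> under W_J, one of least height is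
  proportional to some \<open>\<alpha>\<close> in \<open>J\<close>: otherwise a simple reflection
  would lower it further while keeping it positive. Hence \<open>s \<gamma>\<close> is conjugate to
  \<open>s \<alpha>\<close> within W_J.\<close>

lemma refl_mem_parabolic:
  assumes J: "J \<subseteq> I" and \<gamma>: "\<gamma> \<in> \<Phi>" "\<gamma> \<in> span J"
  shows "s \<gamma> \<in> reflection_group scale \<Phi> J"
proof -
  let ?WJ = "reflection_group scale \<Phi> J"
  have *: "s \<gamma> \<in> ?WJ" if p: "pos \<gamma>" and sp: "\<gamma> \<in> span J" for \<gamma>
  proof -
    define A where "A = {y \<in> ?WJ. pos (y \<gamma>)}"
    have "finite A" using finite_W parabolic_subset[OF J] by (auto simp: A_def intro: finite_subset)
    moreover have "id \<in> A" using p by (auto simp: A_def intro: reflection_group.one)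
    ultimately obtain y where y: "y \<in> A" and min: "\<And>z. z \<in> A \<Longrightarrow> height (y \<gamma>) \<le> height (z \<gamma>)"
      using ex_min_if_finite[of "(\<lambda>y. height (y \<gamma>)) ` A"] by (force simp: not_less)
    define \<gamma>' where "\<gamma>' = y \<gamma>"
    have yJ: "y \<in> ?WJ" and pos': "pos \<gamma>'" using y by (auto simp: A_def \<gamma>'_def)
    have yW: "y \<in> W" using yJ parabolic_subset[OF J] by blast
    have sp': "\<gamma>' \<in> span J" using span_parabolic[OF J yJ] sp by (simp add: \<gamma>'_def)
    \<comment> \<open>Expanding the positive norm in simple roots leaves at least one positive
      summand; its simple root is the direction in which the height drops.\<close>
    have "0 < form \<gamma>' \<gamma>'" using pos' form_root_pos pos_root by blast
    also note form_eq_sum_coeff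
    finally obtain \<alpha> where \<alpha>: "\<alpha> \<in> I" "0 < coeff \<gamma>' \<alpha> * form \<alpha> \<gamma>'"
      by (metis (no_types, lifting) not_less sum_nonpos)
    moreover have "0 \<le> coeff \<gamma>' \<alpha>" using pos' by (simp add: pos_def)
    ultimately have c: "coeff \<gamma>' \<alpha> \<noteq> 0" and "0 < form \<alpha> \<gamma>'"
      by (auto simp: zero_less_mult_iff)
    then have f: "0 < coroot scale \<Phi> \<alpha> \<gamma>'"
      using \<alpha> simple_roots form_root_pos by (subst coroot_eq) (auto simp: form_commute)
    \<comment> \<open>The nonzero coordinate, not just the sign of the form, is what keeps the
      reflection inside W_J.\<close>
    have "\<alpha> \<in> J" using c sp' span_subset_simple_iff[OF J] by blast
    then have sJ: "s \<alpha> \<in> ?WJ" by (rule reflection_group.incl)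
    have "height (s \<alpha> \<gamma>') < height \<gamma>'" using f \<alpha>(1) by (simp add: height_refl)
    then have "s \<alpha> \<circ> y \<notin> A" using min[of "s \<alpha> \<circ> y"] by (auto simp: \<gamma>'_def)
    then have "\<not> pos (s \<alpha> \<gamma>')" using sJ yJ by (auto simp: A_def \<gamma>'_def intro: reflection_group.mult)
    then have "s \<gamma>' = s \<alpha>" using refl_eq_simple_refl \<alpha> pos' by blast
    then have "y \<circ> s \<gamma> = s \<alpha> \<circ> y"
      using refl_image_comp[OF yW pos_root[OF p]] by (simp add: \<gamma>'_def)
    then have "s \<gamma> = inv y \<circ> (s \<alpha> \<circ> y)"
      using yW by (metis W_inv_comp(1) comp_assoc id_comp)
    then show ?thesis using sJ yJ by (auto intro: reflection_group.intros)
  qed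
  show ?thesis
    using *[of \<gamma>] *[of "- \<gamma>"] \<gamma> not_pos_iff[of \<gamma>] refl_uminus[of \<gamma>] by (auto simp: span_neg)
qed

lemma simple_generate: "reflection_group scale \<Phi> I = W"
proof
  show "W \<subseteq> reflection_group scale \<Phi> I"
  proof
    fix x assume "x \<in> W"
    then show "x \<in> reflection_group scale \<Phi> I"
          proof induction
      case (incl \<alpha>)
      then show ?case by (intro refl_mem_parabolic) (auto simp: span_simple)
    qed (blast intro: reflection_group.intros)+
  qed
qed (rule parabolic_subset, simp)

text \<open>Reflections are involutions, so the reversed word represents the inverse. A product
  \<open>x \<circ> y\<close> concatenates in the opposite order because the head of a word acts
  first.\<close>

lemma group_word:
  assumes "S \<subseteq> \<Phi>" "x \<in> reflection_group scale \<Phi> S"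
  shows "\<exists>\<alpha>s. set \<alpha>s \<subseteq> S \<and> apply_reflections scale \<Phi> \<alpha>s id = x"
  using assms(2)
proof (induction rule: reflection_group.induct)
  case one
  have "set [] \<subseteq> S \<and> apply_reflections scale \<Phi> [] id = id" by simp
  then show ?case by blast
next
  case (incl \<alpha>)
  then show ?case by (intro exI[of _ "[\<alpha>]"]) (simp add: apply_reflections_def)
next
  case (mult x y)
  then obtain \<alpha>s \<beta>s where "set \<alpha>s \<subseteq> S" "apply_reflections scale \<Phi> \<alpha>s id = x"
    "set \<beta>s \<subseteq> S" "apply_reflections scale \<Phi> \<beta>s id = y" by blast
  then have "set (\<beta>s @ \<alpha>s) \<subseteq> S \<and> apply_reflections scale \<Phi> (\<beta>s @ \<alpha>s) id = x \<circ> y"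
    using apply_reflections_comp[of scale \<Phi> \<alpha>s id y] by (simp add: apply_reflections_append)
  then show ?case by blast
next
  case (inverse x)
  then obtain \<alpha>s where \<alpha>s: "set \<alpha>s \<subseteq> S" "apply_reflections scale \<Phi> \<alpha>s id = x" by blast
  have "apply_reflections scale \<Phi> (rev \<alpha>s) (apply_reflections scale \<Phi> \<alpha>s id) = id"
    using \<alpha>s(1)
  proof (induction \<alpha>s rule: rev_induct)
    case (snoc \<alpha> \<alpha>s)
    then have "\<alpha> \<in> \<Phi>" using assms(1) by auto
    have "apply_reflections scale \<Phi> (rev (\<alpha>s @ [\<alpha>])) (apply_reflections scale \<Phi> (\<alpha>s @ [\<alpha>]) id)
        = apply_reflections scale \<Phi> (rev \<alpha>s) ((s \<alpha> \<circ> s \<alpha>) \<circ> apply_reflections scale \<Phi> \<alpha>s id)"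
      by (simp add: apply_reflections_def comp_assoc)
    also have "\<dots> = id" 
      unfolding refl_comp_refl[OF \<open>\<alpha> \<in> \<Phi>\<close>] id_comp using snoc by (simp add: id_def)
    finally show ?case .
  qed simp
  then have "apply_reflections scale \<Phi> (rev \<alpha>s) id \<circ> x = id"
    using \<alpha>s(2) apply_reflections_comp[of scale \<Phi> "rev \<alpha>s" id x] by simp
  moreover have "x \<circ> inv x = id"
    using inverse.hyps reflection_group_mono[OF assms(1)] W_inv_comp by blast
  ultimately have "apply_reflections scale \<Phi> (rev \<alpha>s) id = inv x"
    by (metis comp_assoc comp_id id_comp)
  moreover have "set (rev \<alpha>s) \<subseteq> S" using \<alpha>s(1) by simp
  ultimately show ?case by blast
qed

subsection \<open>Length and Bruhat order\<close>

abbreviation len ("\<ell>") where "len \<equiv> weyl_length scale \<Phi> I"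

lemma len_le: "set \<alpha>s \<subseteq> I \<Longrightarrow> \<ell> (apply_reflections scale \<Phi> \<alpha>s id) \<le> length \<alpha>s"
  unfolding weyl_length_def by (rule Least_le) blast

lemma len_word:
  assumes "w \<in> W"
  shows "\<exists>\<alpha>s. set \<alpha>s \<subseteq> I \<and> length \<alpha>s = \<ell> w \<and> apply_reflections scale \<Phi> \<alpha>s id = w"
proof -
  have "\<exists>n \<alpha>s. set \<alpha>s \<subseteq> I \<and> length \<alpha>s = n \<and> apply_reflections scale \<Phi> \<alpha>s id = w"
    using group_word[OF simple_roots] assms simple_generate by blast
  from LeastI_ex[OF this] show ?thesis unfolding weyl_length_def by blast
qed

text \<open>The last letter is the leftmost factor \<open>s \<alpha>\<close>. If it makes
  \<open>\<gamma>\<close> negative, then \<open>s \<gamma> = s \<alpha>\<close> and the letter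
  cancels; otherwise \<open>s \<gamma> \<circ> s \<alpha> = s \<alpha> \<circ> s (s \<alpha>
  \<gamma>)\<close> passes the question to the shorter word, with another positive root.\<close>

lemma strong_exchange:
  assumes "set \<alpha>s \<subseteq> I" "pos \<gamma>" "\<not> pos (inv (apply_reflections scale \<Phi> \<alpha>s id) \<gamma>)"
  shows "\<exists>\<beta>s. set \<beta>s \<subseteq> I \<and> length \<alpha>s = Suc (length \<beta>s) \<and>
    s \<gamma> \<circ> apply_reflections scale \<Phi> \<alpha>s id = apply_reflections scale \<Phi> \<beta>s id"
  using assms
proof (induction \<alpha>s arbitrary: \<gamma> rule: rev_induct)
  case Nil
  then show ?case by simp
next
  case (snoc \<alpha> \<alpha>s)
  define w where "w = apply_reflections scale \<Phi> \<alpha>s id"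
  have \<alpha>: "\<alpha> \<in> I" "\<alpha> \<in> \<Phi>" and \<gamma>: "\<gamma> \<in> \<Phi>" using snoc.prems simple_roots pos_root by auto
  have "set \<alpha>s \<subseteq> \<Phi>" using snoc.prems simple_roots by auto
  then have w: "w \<in> W" unfolding w_def by (rule apply_reflections_in_group)
  have inv_s: "inv (s \<alpha>) = s \<alpha>" using \<alpha> by (simp add: inv_unique_comp)
  show ?case
  proof (cases "pos (s \<alpha> \<gamma>)")
    case False
    then have "s \<gamma> \<circ> (s \<alpha> \<circ> w) = w"
      using refl_eq_simple_refl[OF \<alpha>(1) snoc.prems(2)] \<alpha> by (simp flip: comp_assoc)
    then have "s \<gamma> \<circ> apply_reflections scale \<Phi> (\<alpha>s @ [\<alpha>]) id = apply_reflections scale \<Phi> \<alpha>s id"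
      by (simp add: w_def)
    moreover have "set \<alpha>s \<subseteq> I" "length (\<alpha>s @ [\<alpha>]) = Suc (length \<alpha>s)"
      using snoc.prems by simp_all
    ultimately show ?thesis by blast
  next
    case True
    have "\<not> pos (inv (s \<alpha> \<circ> w) \<gamma>)"
      using snoc.prems(3) unfolding w_def apply_reflections_snoc .
    then have nw: "\<not> pos (inv (apply_reflections scale \<Phi> \<alpha>s id) (s \<alpha> \<gamma>))"
      using \<alpha> w by (simp add: W_inv_of_comp inv_s w_def)
    have \<alpha>s: "set \<alpha>s \<subseteq> I" using snoc.prems by simp
    from snoc.IH[OF \<alpha>s True nw] obtain \<beta>s where \<beta>s: "set \<beta>s \<subseteq> I" "length \<alpha>s = Suc (length \<beta>s)"
      "s (s \<alpha> \<gamma>) \<circ> w = apply_reflections scale \<Phi> \<beta>s id"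
      unfolding w_def by blast
    have "s \<alpha> \<circ> s (s \<alpha> \<gamma>) = s \<gamma> \<circ> s \<alpha>"
      using refl_image_comp[of "s \<alpha>" "s \<alpha> \<gamma>"] \<alpha> \<gamma> by (simp add: refl_root)
    then have "s \<gamma> \<circ> (s \<alpha> \<circ> w) = apply_reflections scale \<Phi> (\<beta>s @ [\<alpha>]) id"
      using \<beta>s(3) by (metis apply_reflections_snoc comp_assoc)
    then have "s \<gamma> \<circ> apply_reflections scale \<Phi> (\<alpha>s @ [\<alpha>]) id
        = apply_reflections scale \<Phi> (\<beta>s @ [\<alpha>]) id"
      by (simp add: w_def)
    moreover have "set (\<beta>s @ [\<alpha>]) \<subseteq> I" "length (\<alpha>s @ [\<alpha>]) = Suc (length (\<beta>s @ [\<alpha>]))"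
      using \<beta>s \<alpha> by simp_all
    ultimately show ?thesis by blast
  qed
qed

text \<open>If \<open>w \<delta>\<close> is negative, strong exchange for
  \<open>- w \<delta>\<close> deletes a letter of a shortest word. The opposite case is the same
  fact for \<open>w \<circ> s \<delta>\<close>, which sends \<open>\<delta>\<close> to
  \<open>- w \<delta>\<close>; therefore \<open>dec\<close> is stated for every group
  element.\<close>

lemma len_comp_refl_iff:
  assumes w: "w \<in> W" and \<delta>: "pos \<delta>"
  shows "\<ell> w < \<ell> (w \<circ> s \<delta>) \<longleftrightarrow> pos (w \<delta>)"
proof -
  have dec: "\<ell> (w \<circ> s \<delta>) < \<ell> w" if w: "w \<in> W" and neg: "\<not> pos (w \<delta>)" for w
  proof -
    have \<delta>\<Phi>: "\<delta> \<in> \<Phi>" using \<delta> pos_root by blast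
    obtain \<alpha>s where \<alpha>s: "set \<alpha>s \<subseteq> I" "length \<alpha>s = \<ell> w" "apply_reflections scale \<Phi> \<alpha>s id = w"
      using len_word[OF w] by blast
    have pw: "pos (- w \<delta>)" using neg not_pos_iff W_root w \<delta>\<Phi> by blast
    moreover have "\<not> pos (inv w (- w \<delta>))"
      using w \<delta> \<delta>\<Phi> not_pos_iff[of \<delta>] by (simp add: W_uminus)
    ultimately obtain \<beta>s where \<beta>s: "set \<beta>s \<subseteq> I" "\<ell> w = Suc (length \<beta>s)"
      "s (- w \<delta>) \<circ> w = apply_reflections scale \<Phi> \<beta>s id"
      using strong_exchange[OF \<alpha>s(1), of "- w \<delta>"] \<alpha>s by auto
    have "s (- w \<delta>) \<circ> w = w \<circ> s \<delta>" using refl_uminus refl_image_comp w \<delta>\<Phi> W_root by simp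
    then show ?thesis using \<beta>s len_le[of \<beta>s] by simp
  qed
  show ?thesis
  proof
    assume "\<ell> w < \<ell> (w \<circ> s \<delta>)"
    then show "pos (w \<delta>)" using dec[OF w] by fastforce
  next
    assume "pos (w \<delta>)"
    have \<delta>\<Phi>: "\<delta> \<in> \<Phi>" using \<delta> pos_root by blast
    have "\<not> pos ((w \<circ> s \<delta>) \<delta>)"
      using \<open>pos (w \<delta>)\<close> not_pos_iff[of "w \<delta>"] W_root[OF w \<delta>\<Phi>] \<delta>\<Phi> w by (auto simp: W_uminus)
    from dec[of "w \<circ> s \<delta>", OF _ this] show "\<ell> w < \<ell> (w \<circ> s \<delta>)" using w \<delta>\<Phi> by (simp add: comp_assoc)
  qed
qed

section \<open>Reflection chains with roots from a given set\<close>

text \<open>One relation covers three cases: \<Phi> gives the Bruhat order, the roots of w1 w2^-1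
  give good pairs, and \<Phi>_J gives the order on W_J. The length is always that of the whole
  group.\<close>

definition refl_step :: "'v set \<Rightarrow> ('v \<Rightarrow> 'v) \<Rightarrow> ('v \<Rightarrow> 'v) \<Rightarrow> bool" where
  "refl_step S x y \<longleftrightarrow> (\<exists>\<alpha>\<in>S. y = s \<alpha> \<circ> x) \<and> \<ell> x < \<ell> y"

lemma bruhat_step_eq: "bruhat_step scale \<Phi> I = refl_step \<Phi>"
  by (simp add: fun_eq_iff bruhat_step_def refl_step_def)

lemma refl_step_mono: "S \<subseteq> T \<Longrightarrow> refl_step S x y \<Longrightarrow> refl_step T x y"
  by (auto simp: refl_step_def)

lemma refl_step_W: "S \<subseteq> \<Phi> \<Longrightarrow> refl_step S x y \<Longrightarrow> x \<in> W \<Longrightarrow> y \<in> W"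
  unfolding refl_step_def by (blast intro: comp_W refl_W)

lemma refl_steps_W: "(refl_step S)\<^sup>*\<^sup>* x y \<Longrightarrow> S \<subseteq> \<Phi> \<Longrightarrow> x \<in> W \<Longrightarrow> y \<in> W"
  by (induction rule: rtranclp_induct) (blast intro: refl_step_W)+

text \<open>A left reflection in \<open>\<alpha>\<close> is a right reflection in
  \<open>inv x \<alpha>\<close>. Its sign may be chosen positive without changing the reflection,
  and closure under negation keeps the image in \<open>S\<close>; the length rule then
  applies.\<close>

lemma refl_step_iff:
  assumes "x \<in> W" "S \<subseteq> \<Phi>" and neg: "\<And>\<alpha>. \<alpha> \<in> S \<Longrightarrow> - \<alpha> \<in> S"
  shows "refl_step S x y \<longleftrightarrow> (\<exists>\<delta>. pos \<delta> \<and> x \<delta> \<in> S \<and> pos (x \<delta>) \<and> y = x \<circ> s \<delta>)"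
proof
  assume "refl_step S x y"
  then obtain \<alpha> where \<alpha>: "\<alpha> \<in> S" "y = s \<alpha> \<circ> x" and less: "\<ell> x < \<ell> y"
    by (auto simp: refl_step_def)
  define \<delta>' where "\<delta>' = inv x \<alpha>"
  have \<delta>': "\<delta>' \<in> \<Phi>" "x \<delta>' = \<alpha>"
    using \<alpha> assms by (auto simp: \<delta>'_def intro: W_root)
  define \<delta> where "\<delta> = (if pos \<delta>' then \<delta>' else - \<delta>')"
  have "pos \<delta>" using \<delta>' not_pos_iff by (auto simp: \<delta>_def)
  moreover have "x \<delta> \<in> S" using \<delta>' \<alpha> neg assms(1) by (simp add: \<delta>_def W_uminus)
  moreover have y: "y = x \<circ> s \<delta>"
    using refl_image_comp[OF assms(1) \<delta>'(1)] \<delta>' \<alpha> by (simp add: \<delta>_def refl_uminus)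
  moreover have "pos (x \<delta>)"
    using less len_comp_refl_iff[OF assms(1) \<open>pos \<delta>\<close>] by (simp add: y)
  ultimately show "\<exists>\<delta>. pos \<delta> \<and> x \<delta> \<in> S \<and> pos (x \<delta>) \<and> y = x \<circ> s \<delta>" by blast
next
  assume "\<exists>\<delta>. pos \<delta> \<and> x \<delta> \<in> S \<and> pos (x \<delta>) \<and> y = x \<circ> s \<delta>"
  then obtain \<delta> where \<delta>: "pos \<delta>" "x \<delta> \<in> S" "pos (x \<delta>)" "y = x \<circ> s \<delta>" by blast
  moreover have "y = s (x \<delta>) \<circ> x"
    using refl_image_comp[OF assms(1) pos_root[OF \<delta>(1)]] \<delta>(4) by simp
  ultimately show "refl_step S x y"
    using len_comp_refl_iff[OF assms(1) \<delta>(1)] unfolding refl_step_def by blast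
qed

lemma bruhat_less_len: "bruhat_less scale \<Phi> I x y \<Longrightarrow> \<ell> x < \<ell> y"
proof -
  assume less: "bruhat_less scale \<Phi> I x y"
  then have "(refl_step \<Phi>)\<^sup>*\<^sup>* x y" by (simp add: bruhat_less_def bruhat_le_def bruhat_step_eq)
  then have "x = y \<or> \<ell> x < \<ell> y"
    by (induction rule: rtranclp_induct) (auto simp: refl_step_def)
  then show ?thesis using less by (auto simp: bruhat_less_def)
qed

lemma bruhat_less_refl_step:
  assumes "S \<subseteq> \<Phi>" "x \<in> W" "refl_step S x y"
  shows "bruhat_less scale \<Phi> I x y"
proof -
  have "refl_step \<Phi> x y" using assms refl_step_mono by blast
  moreover have "x \<noteq> y" using assms by (auto simp: refl_step_def)
  ultimately show ?thesis
    using assms refl_step_W by (auto simp: bruhat_less_def bruhat_le_def bruhat_step_eq)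
qed

lemma reflection_chain_iff:
  assumes "w \<in> W" "S \<subseteq> \<Phi>"
  shows "(\<exists>\<alpha>s. set \<alpha>s \<subseteq> S \<and> w' = apply_reflections scale \<Phi> \<alpha>s w \<and>
      (\<forall>i<length \<alpha>s. bruhat_less scale \<Phi> I
        (apply_reflections scale \<Phi> (take i \<alpha>s) w)
        (apply_reflections scale \<Phi> (take (Suc i) \<alpha>s) w))) \<longleftrightarrow> (refl_step S)\<^sup>*\<^sup>* w w'"
    (is "(\<exists>\<alpha>s. ?chain w' \<alpha>s) \<longleftrightarrow> _")
proof
  assume "\<exists>\<alpha>s. ?chain w' \<alpha>s"
  then obtain \<alpha>s where \<alpha>s: "?chain w' \<alpha>s" by blast
  have "(refl_step S)\<^sup>*\<^sup>* w (apply_reflections scale \<Phi> (take n \<alpha>s) w)" if "n \<le> length \<alpha>s" for n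
    using that
  proof (induction n)
    case (Suc n)
    then have n: "n < length \<alpha>s" and "\<alpha>s ! n \<in> S" using \<alpha>s by auto
    \<comment> \<open>The strict Bruhat relation contributes only the increase in length; the
      reflection is read off from the list.\<close>
    then have "refl_step S (apply_reflections scale \<Phi> (take n \<alpha>s) w)
        (apply_reflections scale \<Phi> (take (Suc n) \<alpha>s) w)"
      using \<alpha>s bruhat_less_len unfolding refl_step_def
      by (metis apply_reflections_snoc take_Suc_conv_app_nth)
    then show ?case using Suc.IH n by (meson less_imp_le rtranclp.rtrancl_into_rtrancl)
  qed simp
  from this[of "length \<alpha>s"] show "(refl_step S)\<^sup>*\<^sup>* w w'" using \<alpha>s by simp
next
  assume "(refl_step S)\<^sup>*\<^sup>* w w'"
  then show "\<exists>\<alpha>s. ?chain w' \<alpha>s"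
  proof (induction rule: rtranclp_induct)
    case base
    have "?chain w []" by simp
    then show ?case by blast
  next
    case (step y z)
    then obtain \<alpha>s where \<alpha>s: "?chain y \<alpha>s" by blast
    obtain \<alpha> where \<alpha>: "\<alpha> \<in> S" "z = s \<alpha> \<circ> y" using step.hyps by (auto simp: refl_step_def)
    have "y \<in> W" using step.hyps assms refl_steps_W by blast
    then have "bruhat_less scale \<Phi> I y z" using step.hyps assms bruhat_less_refl_step by blast
    then have "?chain z (\<alpha>s @ [\<alpha>])"
      using \<alpha>s \<alpha> by (auto simp: less_Suc_eq)
    then show ?case by blast
  qed
qed

lemma good_pair_iff:
  assumes "w1 \<in> W" "w2 \<in> W"
  shows "good_pair scale \<Phi> I w1 w2 \<longleftrightarrow> (refl_step (roots_of \<Phi> (w1 \<circ> inv w2)))\<^sup>*\<^sup>* w1 w2"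
proof -
  let ?S = "roots_of \<Phi> (w1 \<circ> inv w2)"
  have S: "?S \<subseteq> \<Phi>" by (auto simp: roots_of_def)
  have "(refl_step \<Phi>)\<^sup>*\<^sup>* w1 w2" if "(refl_step ?S)\<^sup>*\<^sup>* w1 w2"
    using that refl_step_mono[OF S] by (metis mono_rtranclp)
  then show ?thesis
    using assms unfolding good_pair_def reflection_chain_iff[OF assms(1) S]
    by (auto simp: bruhat_le_def bruhat_step_eq)
qed

section \<open>Minimal coset representatives\<close>

lemma min_coset_reps_iff:
  assumes "J \<subseteq> I"
  shows "u \<in> min_coset_reps scale \<Phi> I J \<longleftrightarrow> u \<in> W \<and> (\<forall>\<alpha>\<in>J. pos (u \<alpha>))"
proof -
  have "bruhat_less scale \<Phi> I u (u \<circ> s \<alpha>) \<longleftrightarrow> pos (u \<alpha>)" if "u \<in> W" "\<alpha> \<in> J" for \<alpha>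
  proof -
    have \<alpha>: "pos \<alpha>" using that assms pos_simple by blast
    have "refl_step \<Phi> u (u \<circ> s \<alpha>)" if "pos (u \<alpha>)"
      using refl_step_iff[OF \<open>u \<in> W\<close>, of \<Phi>] that \<alpha> root_uminus pos_root by blast
    then show ?thesis
      using bruhat_less_len bruhat_less_refl_step[OF _ \<open>u \<in> W\<close>, of \<Phi>]
        len_comp_refl_iff[OF \<open>u \<in> W\<close> \<alpha>] by blast
  qed
  then show ?thesis by (auto simp: min_coset_reps_def)
qed

text \<open>Take a shortest element \<open>u\<close> of the coset: if it made some
  \<open>\<alpha>\<close> in \<open>J\<close> negative, the element
  \<open>u \<circ> s \<alpha>\<close> of the same coset would be shorter.\<close>

lemma min_coset_rep_exists:
  assumes J: "J \<subseteq> I" and w: "w \<in> W"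
  shows "\<exists>u\<in>min_coset_reps scale \<Phi> I J. \<exists>y\<in>reflection_group scale \<Phi> J. w = u \<circ> y"
proof -
  let ?WJ = "reflection_group scale \<Phi> J"
  have "\<exists>y. y \<in> ?WJ \<and> (\<forall>z. z \<in> ?WJ \<longrightarrow> \<ell> (w \<circ> y) \<le> \<ell> (w \<circ> z))"
    by (rule ex_has_least_nat) (rule reflection_group.one)
  then obtain y where y: "y \<in> ?WJ" and min: "\<And>z. z \<in> ?WJ \<Longrightarrow> \<ell> (w \<circ> y) \<le> \<ell> (w \<circ> z)" by blast
  have yW: "y \<in> W" using y parabolic_subset[OF J] by blast
  define u where "u = w \<circ> y"
  have uW: "u \<in> W" using w yW by (simp add: u_def)
  have "pos (u \<alpha>)" if "\<alpha> \<in> J" for \<alpha>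
  proof (rule ccontr)
    assume neg: "\<not> pos (u \<alpha>)"
    have \<alpha>: "pos \<alpha>" "\<alpha> \<in> \<Phi>" using that J pos_simple pos_root by blast+
    have "pos ((u \<circ> s \<alpha>) \<alpha>)"
      using neg uW \<alpha> not_pos_iff[of "u \<alpha>"] W_root by (simp add: W_uminus)
    then have "\<ell> (u \<circ> s \<alpha>) < \<ell> (u \<circ> s \<alpha> \<circ> s \<alpha>)"
      using len_comp_refl_iff[of "u \<circ> s \<alpha>" \<alpha>] uW \<alpha> by simp
    then have "\<ell> (w \<circ> (y \<circ> s \<alpha>)) < \<ell> (w \<circ> y)" using \<alpha> by (simp add: comp_assoc u_def)
    moreover have "y \<circ> s \<alpha> \<in> ?WJ" using y that by (intro reflection_group.mult reflection_group.incl)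
    ultimately show False using min leD by blast
  qed
  then have "u \<in> min_coset_reps scale \<Phi> I J" using uW J by (simp add: min_coset_reps_iff)
  moreover have "inv y \<in> ?WJ" using y by (rule reflection_group.inverse)
  moreover have "w = u \<circ> inv y" using yW by (simp add: u_def comp_assoc)
  ultimately show ?thesis by blast
qed

text \<open>A positive root in the span of \<open>J\<close> is a nonnegative combination of
  \<open>J\<close>, whose members \<open>u\<close> sends to positive roots; the negative roots
  follow by negation.\<close>

lemma pos_min_coset_rep_iff:
  assumes J: "J \<subseteq> I" and u: "u \<in> min_coset_reps scale \<Phi> I J" and \<beta>: "\<beta> \<in> \<Phi>" "\<beta> \<in> span J"
  shows "pos (u \<beta>) \<longleftrightarrow> pos \<beta>"
proof -
  have uW: "u \<in> W" and uJ: "\<And>\<alpha>. \<alpha> \<in> J \<Longrightarrow> pos (u \<alpha>)" using u J by (auto simp: min_coset_reps_iff)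
  have *: "pos (u \<beta>)" if \<beta>: "pos \<beta>" "\<beta> \<in> span J" for \<beta>
  proof -
    have "u \<beta> = (\<Sum>\<alpha>\<in>I. scale (coeff \<beta> \<alpha>) (u \<alpha>))"
      by (subst (1) sum_coeff[symmetric]) (simp add: uW W_sum W_scale)
    moreover have "0 \<le> coeff \<beta> \<alpha> * coeff (u \<alpha>) \<delta>" for \<alpha> \<delta>
      using \<beta> uJ[of \<alpha>] span_subset_simple_iff[OF J, of \<beta>] by (cases "\<alpha> \<in> J") (auto simp: pos_def)
    ultimately have "0 \<le> coeff (u \<beta>) \<delta>" for \<delta>
      by (simp add: coeff_sum coeff_scale sum_nonneg)
    then show ?thesis using \<beta> uW W_root by (simp add: pos_def)
  qed
  show ?thesis
    using *[of \<beta>] *[of "- \<beta>"] \<beta> not_pos_iff[of \<beta>] not_pos_iff[of "u \<beta>"] uW W_root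
    by (auto simp: W_uminus span_neg)
qed

text \<open>As \<open>x = y \<circ> s \<delta>\<close> with \<open>y \<delta>\<close> negative, \<open>\<delta>\<close> lies in \<open>\<Phi>\<^sub>J\<close>: the group \<open>W\<^sub>J\<close> permutes the
  positive roots outside \<open>\<Phi>\<^sub>J\<close>.\<close>

lemma refl_step_parabolic:
  assumes J: "J \<subseteq> I" and x: "x \<in> W" and y: "y \<in> reflection_group scale \<Phi> J" and step: "refl_step \<Phi> x y"
  shows "x \<in> reflection_group scale \<Phi> J" "refl_step (root_subsystem scale \<Phi> J) x y"
proof -
  obtain \<delta> where \<delta>: "pos \<delta>" "pos (x \<delta>)" "y = x \<circ> s \<delta>"
    using step refl_step_iff[OF x, of \<Phi>] root_uminus by auto
  have \<delta>\<Phi>: "\<delta> \<in> \<Phi>" using \<delta> pos_root by blast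
  have "\<not> pos (y \<delta>)"
    using \<delta> \<delta>\<Phi> x not_pos_iff[of "x \<delta>"] pos_root by (auto simp: W_uminus)
  then have sp: "\<delta> \<in> span J" using pos_parabolic J y \<delta> by blast
  then have "s \<delta> \<in> reflection_group scale \<Phi> J" using refl_mem_parabolic J \<delta>\<Phi> by blast
  moreover have "x = y \<circ> s \<delta>" using \<delta> \<delta>\<Phi> by (simp add: comp_assoc)
  ultimately show xJ: "x \<in> reflection_group scale \<Phi> J"
    using y reflection_group.mult by blast
  have "x \<delta> \<in> root_subsystem scale \<Phi> J"
    using span_parabolic[OF J xJ] sp \<delta> pos_root by (simp add: root_subsystem_def)
  then show "refl_step (root_subsystem scale \<Phi> J) x y"
    using refl_step_iff[OF x, of "root_subsystem scale \<Phi> J"] \<delta>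
    by (auto simp: root_subsystem_def root_uminus span_neg)
qed

text \<open>Membership in W_J passes from the upper end of a step to the lower one, so the induction
  carries membership of the current endpoint as a premise and descends from
  \<open>y2\<close>.\<close>

lemma bruhat_le_parabolic_iff:
  assumes J: "J \<subseteq> I" and y: "y1 \<in> reflection_group scale \<Phi> J" "y2 \<in> reflection_group scale \<Phi> J"
  shows "bruhat_le scale \<Phi> I y1 y2 \<longleftrightarrow> (refl_step (root_subsystem scale \<Phi> J))\<^sup>*\<^sup>* y1 y2"
proof -
  have W: "y1 \<in> W" "y2 \<in> W" using y parabolic_subset[OF J] by auto
  have "(refl_step (root_subsystem scale \<Phi> J))\<^sup>*\<^sup>* y1 y2" if "(refl_step \<Phi>)\<^sup>*\<^sup>* y1 y2"
    using that y(2)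
  proof (induction rule: rtranclp_induct)
    case (step y z)
    have "y \<in> W" using step.hyps W refl_steps_W by blast
    from refl_step_parabolic[OF J this step.prems step.hyps(2)] step.IH
    show ?case by (meson rtranclp.rtrancl_into_rtrancl)
  qed simp
  moreover have "(refl_step \<Phi>)\<^sup>*\<^sup>* y1 y2" if "(refl_step (root_subsystem scale \<Phi> J))\<^sup>*\<^sup>* y1 y2"
    using that refl_step_mono[of "root_subsystem scale \<Phi> J" \<Phi>]
    by (metis inf_le1 mono_rtranclp root_subsystem_def)
  ultimately show ?thesis using W by (auto simp: bruhat_le_def bruhat_step_eq)
qed

section \<open>Translation of chains from W_J to u W_J v^-1\<close>

text \<open>With steps written on the right, substitute \<open>\<delta> = v \<epsilon>\<close>. The
  two sign conditions concern \<open>\<epsilon>\<close> and \<open>y \<epsilon>\<close>, both in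
  \<Phi>_J, where \<open>v\<close> and \<open>u\<close> preserve signs.\<close>

lemma refl_step_translate_iff:
  assumes J: "J \<subseteq> I"
    and u: "u \<in> min_coset_reps scale \<Phi> I J" and v: "v \<in> min_coset_reps scale \<Phi> I J"
    and y: "y \<in> reflection_group scale \<Phi> J"
  shows "refl_step (u ` root_subsystem scale \<Phi> J) (u \<circ> y \<circ> inv v) z \<longleftrightarrow>
    (\<exists>y'. refl_step (root_subsystem scale \<Phi> J) y y' \<and> z = u \<circ> y' \<circ> inv v)"
proof -
  let ?R = "root_subsystem scale \<Phi> J"
  have W: "u \<in> W" "v \<in> W" "y \<in> W"
    using u v y parabolic_subset[OF J] by (auto simp: min_coset_reps_def)
  have R: "?R \<subseteq> \<Phi>" "\<And>\<alpha>. \<alpha> \<in> ?R \<Longrightarrow> - \<alpha> \<in> ?R"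
    by (auto simp: root_subsystem_def root_uminus span_neg)
  \<comment> \<open>The condition on roots speaks of \<open>y \<epsilon>\<close>, whereas the sign
    comparison for \<open>v\<close> needs \<open>\<epsilon>\<close> itself in \<Phi>_J.\<close>
  have yR: "y \<epsilon> \<in> ?R \<longleftrightarrow> \<epsilon> \<in> ?R" if "\<epsilon> \<in> \<Phi>" for \<epsilon>
    using that W W_root span_parabolic[OF J y] by (simp add: root_subsystem_def)
  have uR: "u ` ?R \<subseteq> \<Phi>" using R(1) W W_root by blast
  have uR_neg: "- \<alpha> \<in> u ` ?R" if "\<alpha> \<in> u ` ?R" for \<alpha>
    using that R(2) W_uminus[OF W(1)] by (metis (no_types, lifting) image_iff)
  have inj: "u a \<in> u ` ?R \<longleftrightarrow> a \<in> ?R" for a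
    using W W_bij bij_is_inj inj_image_mem_iff by metis
  have posR: "pos (u \<epsilon>) \<longleftrightarrow> pos \<epsilon>" "pos (v \<epsilon>) \<longleftrightarrow> pos \<epsilon>" if "\<epsilon> \<in> ?R" for \<epsilon>
    using that pos_min_coset_rep_iff[OF J] u v by (auto simp: root_subsystem_def)
  have conj: "inv v \<circ> s (v \<epsilon>) = s \<epsilon> \<circ> inv v" if "\<epsilon> \<in> \<Phi>" for \<epsilon>
    using refl_image_comp[of "inv v" "v \<epsilon>"] that W W_root by simp
  have "refl_step (u ` ?R) (u \<circ> y \<circ> inv v) z \<longleftrightarrow>
      (\<exists>\<delta>. pos \<delta> \<and> u (y (inv v \<delta>)) \<in> u ` ?R \<and> pos (u (y (inv v \<delta>))) \<and> z = u \<circ> y \<circ> inv v \<circ> s \<delta>)"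
    using refl_step_iff[OF _ uR uR_neg, of "u \<circ> y \<circ> inv v" z] W by simp
  also have "\<dots> \<longleftrightarrow> (\<exists>\<epsilon>. pos \<epsilon> \<and> y \<epsilon> \<in> ?R \<and> pos (y \<epsilon>) \<and> z = u \<circ> (y \<circ> s \<epsilon>) \<circ> inv v)"
    (is "(\<exists>\<delta>. ?P \<delta>) \<longleftrightarrow> (\<exists>\<epsilon>. ?Q \<epsilon>)")
  proof -
    have "?P (v \<epsilon>) \<longleftrightarrow> ?Q \<epsilon>" if "\<epsilon> \<in> \<Phi>" for \<epsilon>
    proof -
      have "u \<circ> y \<circ> inv v \<circ> s (v \<epsilon>) = u \<circ> (y \<circ> s \<epsilon>) \<circ> inv v"
        by (simp only: comp_assoc conj[OF that])
      then have "?P (v \<epsilon>) \<longleftrightarrow>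
          pos (v \<epsilon>) \<and> y \<epsilon> \<in> ?R \<and> pos (u (y \<epsilon>)) \<and> z = u \<circ> (y \<circ> s \<epsilon>) \<circ> inv v"
        using inj W by (simp only: W_inv_apply)
      then show ?thesis using posR yR[OF that] by blast
    qed
    moreover have "?P \<delta> \<Longrightarrow> \<exists>\<epsilon>\<in>\<Phi>. \<delta> = v \<epsilon>" for \<delta>
      using W W_image_roots pos_root by blast
    moreover have "?Q \<epsilon> \<Longrightarrow> \<epsilon> \<in> \<Phi>" for \<epsilon> using pos_root by blast
    ultimately show ?thesis by blast
  qed
  also have "\<dots> \<longleftrightarrow> (\<exists>y'. refl_step ?R y y' \<and> z = u \<circ> y' \<circ> inv v)"
  proof -
    have "refl_step ?R y y' \<longleftrightarrow> (\<exists>\<epsilon>. pos \<epsilon> \<and> y \<epsilon> \<in> ?R \<and> pos (y \<epsilon>) \<and> y' = y \<circ> s \<epsilon>)" for y'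
      using W(3) R by (rule refl_step_iff)
    then show ?thesis by auto
  qed
  finally show ?thesis .
qed

lemma refl_steps_translate_iff:
  assumes J: "J \<subseteq> I"
    and u: "u \<in> min_coset_reps scale \<Phi> I J" and v: "v \<in> min_coset_reps scale \<Phi> I J"
    and y1: "y1 \<in> reflection_group scale \<Phi> J" and y2: "y2 \<in> reflection_group scale \<Phi> J"
  shows "(refl_step (u ` root_subsystem scale \<Phi> J))\<^sup>*\<^sup>* (u \<circ> y1 \<circ> inv v) (u \<circ> y2 \<circ> inv v) \<longleftrightarrow>
    (refl_step (root_subsystem scale \<Phi> J))\<^sup>*\<^sup>* y1 y2"
proof -
  let ?R = "root_subsystem scale \<Phi> J"
  have W: "u \<in> W" "v \<in> W" using u v by (auto simp: min_coset_reps_def)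
  have stay: "y' \<in> reflection_group scale \<Phi> J"
    if "y \<in> reflection_group scale \<Phi> J" "refl_step ?R y y'" for y y'
    using that refl_mem_parabolic[OF J]
    by (auto simp: refl_step_def root_subsystem_def intro!: reflection_group.mult)
  have "y \<in> reflection_group scale \<Phi> J \<and>
      (refl_step (u ` ?R))\<^sup>*\<^sup>* (u \<circ> y1 \<circ> inv v) (u \<circ> y \<circ> inv v)"
    if "(refl_step ?R)\<^sup>*\<^sup>* y1 y" for y
    using that
  proof (induction rule: rtranclp_induct)
    case (step y z)
    then have "refl_step (u ` ?R) (u \<circ> y \<circ> inv v) (u \<circ> z \<circ> inv v)"
      using refl_step_translate_iff[OF J u v] by metis
    then show ?case using step stay by (meson rtranclp.rtrancl_into_rtrancl)
  qed (use y1 in simp)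
  \<comment> \<open>Conversely, a chain starting in u W_J v^-1 with roots from u(\<Phi>_J) never
    leaves that set, so it can be pulled back step by step.\<close>
  moreover have "\<exists>y\<in>reflection_group scale \<Phi> J. (refl_step ?R)\<^sup>*\<^sup>* y1 y \<and> z = u \<circ> y \<circ> inv v"
    if "(refl_step (u ` ?R))\<^sup>*\<^sup>* (u \<circ> y1 \<circ> inv v) z" for z
    using that
  proof (induction rule: rtranclp_induct)
    case (step x z)
    then obtain y where y: "y \<in> reflection_group scale \<Phi> J" "(refl_step ?R)\<^sup>*\<^sup>* y1 y"
      "refl_step (u ` ?R) (u \<circ> y \<circ> inv v) z" by metis
    then obtain y' where y': "refl_step ?R y y'" "z = u \<circ> y' \<circ> inv v"
      using refl_step_translate_iff[OF J u v] by metis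
    have "(refl_step ?R)\<^sup>*\<^sup>* y1 y'" 
      using y(2) y'(1) by (meson rtranclp.rtrancl_into_rtrancl)
    then show ?case using stay[OF y(1) y'(1)] y'(2) by metis
  qed (use y1 in auto)
  moreover have "y = y2" if "u \<circ> y \<circ> inv v = u \<circ> y2 \<circ> inv v" for y
  proof -
    have "inv u \<circ> (u \<circ> y \<circ> inv v) \<circ> v = inv u \<circ> (u \<circ> y2 \<circ> inv v) \<circ> v" by (simp only: that)
    then show ?thesis using W by (simp add: fun_eq_iff)
  qed
  ultimately show ?thesis by metis
qed

subsection \<open>Stabilisers and parabolic closures\<close>

text \<open>The head of a shortest word is the rightmost factor; cancelling it shortens
  \<open>u\<close>, so the length rule makes its root negative under \<open>u\<close>.\<close>

lemma neg_simple_exists: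
  assumes "u \<in> W" "u \<noteq> id"
  shows "\<exists>\<alpha>\<in>I. \<not> pos (u \<alpha>)"
proof -
  obtain \<alpha>s where \<alpha>s: "set \<alpha>s \<subseteq> I" "length \<alpha>s = \<ell> u" "apply_reflections scale \<Phi> \<alpha>s id = u"
    using len_word assms by blast
  with assms obtain \<alpha> \<beta>s where eq: "\<alpha>s = \<alpha> # \<beta>s" by (cases \<alpha>s) auto
  then have \<alpha>: "\<alpha> \<in> I" "pos \<alpha>" "\<alpha> \<in> \<Phi>" using \<alpha>s pos_simple simple_roots by auto
  have "u = apply_reflections scale \<Phi> \<beta>s (id \<circ> s \<alpha>)"
    using \<alpha>s(3) by (simp add: eq apply_reflections_def)
  then have "u \<circ> s \<alpha> = apply_reflections scale \<Phi> \<beta>s id"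
    using \<alpha>(3) by (simp only: apply_reflections_comp comp_assoc refl_comp_refl comp_id)
  then have "\<ell> (u \<circ> s \<alpha>) < \<ell> u" using \<alpha>s eq len_le[of \<beta>s] by simp
  then show ?thesis using len_comp_refl_iff[OF assms(1) \<alpha>(2)] \<alpha>(1) by auto
qed

lemma form_dominant_nonneg:
  assumes "\<And>\<alpha>. \<alpha> \<in> I \<Longrightarrow> 0 \<le> form \<alpha> p" "pos \<beta>"
  shows "0 \<le> form \<beta> p"
  using assms unfolding form_eq_sum_coeff[of \<beta>] by (intro sum_nonneg mult_nonneg_nonneg) (auto simp: pos_def)

text \<open>For a positive root the form is a sum of nonnegative terms, so it vanishes only if every
  simple root in the support is orthogonal to \<open>p\<close>.\<close>

lemma form_dominant_eq_zero_iff: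
  assumes p: "\<And>\<alpha>. \<alpha> \<in> I \<Longrightarrow> 0 \<le> form \<alpha> p" and \<beta>: "\<beta> \<in> \<Phi>"
  shows "form \<beta> p = 0 \<longleftrightarrow> \<beta> \<in> span {\<alpha> \<in> I. form \<alpha> p = 0}"
proof -
  have *: "form \<beta> p = 0 \<longleftrightarrow> \<beta> \<in> span {\<alpha> \<in> I. form \<alpha> p = 0}" if "pos \<beta>" for \<beta>
  proof -
    have "form \<beta> p = 0 \<longleftrightarrow> (\<forall>\<alpha>\<in>I. coeff \<beta> \<alpha> * form \<alpha> p = 0)"
      unfolding form_eq_sum_coeff[of \<beta>] using finite_simple
      by (rule sum_nonneg_eq_0_iff) (use p that in \<open>auto simp: pos_def\<close>)
    then show ?thesis
      using coeff_outside by (subst span_subset_simple_iff) auto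
  qed
  show ?thesis
    using *[of \<beta>] *[of "- \<beta>"] not_pos_iff[OF \<beta>] span_neg[of "- \<beta>"] span_neg[of \<beta>]
    by (auto simp: form_uminus_left)
qed

lemma parabolic_fixes:
  assumes "J \<subseteq> I" "y \<in> reflection_group scale \<Phi> J" "\<And>\<alpha>. \<alpha> \<in> J \<Longrightarrow> form \<alpha> p = 0"
  shows "y p = p"
  using assms(2)
proof (induction rule: reflection_group.induct)
  case (incl \<alpha>)
  then have "\<alpha> \<in> \<Phi>" "form p \<alpha> = 0" using assms simple_roots by (auto simp: form_commute)
  then show ?case by (simp add: refl_eq)
next
  case (inverse y)
  then have "y \<in> W" using parabolic_subset[OF assms(1)] by blast
  then show ?case using inverse.IH W_inv_apply(1) by metis
qed simp_all

text \<open>After splitting off the part in W_J, the minimal representative \<open>u\<close> also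
  fixes \<open>p\<close>. If it were not the identity, it would negate a simple root with
  \<open>form \<alpha> p > 0\<close>, yet invariance equates this number with
  \<open>form (u \<alpha>) p\<close>, which is at most 0.\<close>

lemma dominant_stabilizer:
  assumes p: "\<And>\<alpha>. \<alpha> \<in> I \<Longrightarrow> 0 \<le> form \<alpha> p" and w: "w \<in> W" "w p = p"
  shows "w \<in> reflection_group scale \<Phi> {\<alpha> \<in> I. form \<alpha> p = 0}"
proof -
  define J where "J = {\<alpha> \<in> I. form \<alpha> p = 0}"
  have J: "J \<subseteq> I" by (auto simp: J_def)
  obtain u y where u: "u \<in> min_coset_reps scale \<Phi> I J" and y: "y \<in> reflection_group scale \<Phi> J"
    and w_eq: "w = u \<circ> y" using min_coset_rep_exists[OF J w(1)] by blast
  have uW: "u \<in> W" and uJ: "\<And>\<alpha>. \<alpha> \<in> J \<Longrightarrow> pos (u \<alpha>)"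
    using u min_coset_reps_iff[OF J] by auto
  have "y p = p" using parabolic_fixes[OF J y] by (simp add: J_def)
  then have up: "u p = p" using w(2) by (simp add: w_eq)
  have "u = id"
  proof (rule ccontr)
    assume "u \<noteq> id"
    then obtain \<alpha> where \<alpha>: "\<alpha> \<in> I" "\<not> pos (u \<alpha>)" using neg_simple_exists[OF uW] by blast
    then have "form \<alpha> p \<noteq> 0" using uJ by (auto simp: J_def)
    then have "0 < form \<alpha> p" using p[OF \<alpha>(1)] by simp
    moreover have "form \<alpha> p = form (u \<alpha>) p" using form_W[OF uW, of \<alpha> p] up by simp
    moreover have "pos (- u \<alpha>)"
      using \<alpha> not_pos_iff[of "u \<alpha>"] uW W_root simple_roots by blast
    ultimately show False using form_dominant_nonneg[OF p, of "- u \<alpha>"] by (simp add: form_uminus_left)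
  qed
  then show ?thesis using y w_eq by (simp add: J_def)
qed

text \<open>An orbit point of maximal height is dominant: \<open>s \<alpha>\<close> changes the
  height by minus the coroot value, so that value cannot be negative.\<close>

lemma dominant_conjugate: "\<exists>x\<in>W. \<forall>\<alpha>\<in>I. 0 \<le> form \<alpha> (x p)"
proof -
  have "finite ((\<lambda>x. - height (x p)) ` W)" "(\<lambda>x. - height (x p)) ` W \<noteq> {}"
    using finite_W id_W by blast+
  from ex_min_if_finite[OF this] obtain x where
    x: "x \<in> W" and max: "\<And>y. y \<in> W \<Longrightarrow> height (y p) \<le> height (x p)" by (force simp: not_less)
  have "0 \<le> form \<alpha> (x p)" if "\<alpha> \<in> I" for \<alpha>
  proof -
    have \<alpha>: "\<alpha> \<in> \<Phi>" using that simple_roots by auto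
    have "height ((s \<alpha> \<circ> x) p) \<le> height (x p)" using max[OF comp_W[OF refl_W[OF \<alpha>] x]] .
    then have "0 \<le> coroot scale \<Phi> \<alpha> (x p)" using height_refl[OF that] by simp
    then show ?thesis
      using form_root_pos[OF \<alpha>] by (simp add: coroot_eq[OF \<alpha>] form_commute zero_le_divide_iff)
  qed
  then show ?thesis using x by blast
qed

section \<open>Moved spaces and fixed vectors\<close>

lemma moved_space_add: "w \<in> W \<Longrightarrow> x \<in> moved_space w \<Longrightarrow> y \<in> moved_space w \<Longrightarrow> x + y \<in> moved_space w"
proof -
  assume w: "w \<in> W" and "x \<in> moved_space w" "y \<in> moved_space w"
  then obtain a b where "x = w a - a" "y = w b - b" by (auto simp: moved_space_def)
  then have "x + y = w (a + b) - (a + b)" using w by (simp add: W_add)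
  then show ?thesis by (auto simp: moved_space_def)
qed

lemma moved_space_scale: "w \<in> W \<Longrightarrow> x \<in> moved_space w \<Longrightarrow> scale c x \<in> moved_space w"
proof -
  assume w: "w \<in> W" and "x \<in> moved_space w"
  then obtain a where "x = w a - a" by (auto simp: moved_space_def)
  then have "scale c x = w (scale c a) - scale c a" using w by (simp add: W_scale scale_right_diff_distrib)
  then show ?thesis by (auto simp: moved_space_def)
qed

lemma W_finite_order:
  assumes "w \<in> W"
  shows "\<exists>n>0. w ^^ n = id"
proof -
  have pow: "w ^^ k \<in> W" for k
  proof (induction k)
    case 0
    have "w ^^ 0 = id" by simp
    then show ?case using id_W by metis
  next
    case (Suc k)
    then have "w \<circ> w ^^ k \<in> W" using assms by (intro comp_W)
    then show ?case by (simp only: funpow.simps)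
  qed
  then have "finite (range (\<lambda>k. w ^^ k))" using finite_W by (auto intro: finite_subset)
  then have "\<not> inj (\<lambda>k. w ^^ k)" using finite_imageD infinite_UNIV_nat by blast
  then obtain i j where ij: "i < j" "w ^^ i = w ^^ j" by (metis injI linorder_neqE_nat)
  have "w ^^ i \<circ> w ^^ (j - i) = w ^^ j" using ij(1) by (simp flip: funpow_add)
  then have "w ^^ i \<circ> w ^^ (j - i) = w ^^ i \<circ> id" by (simp add: ij(2))
  then have "inv (w ^^ i) \<circ> w ^^ i \<circ> w ^^ (j - i) = inv (w ^^ i) \<circ> w ^^ i \<circ> id"
    by (simp only: comp_assoc)
  then have "w ^^ (j - i) = id" using pow by simp
  then show ?thesis using ij by (intro exI[of _ "j - i"]) simp
qed

text \<open>If \<open>x\<close> is orthogonal to all fixed vectors, the sum of the \<open>w\<^sup>k x\<close> is a fixed vector orthogonal to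
  itself, hence zero.\<close>

lemma moved_space_eq_fixed_perp:
  assumes w: "w \<in> W"
  shows "x \<in> moved_space w \<longleftrightarrow> (\<forall>p. w p = p \<longrightarrow> form x p = 0)"
proof
  assume "x \<in> moved_space w"
  then obtain a where x: "x = w a - a" by (auto simp: moved_space_def)
  show "\<forall>p. w p = p \<longrightarrow> form x p = 0"
    using form_W[OF w, of a] by (metis x diff_self form_diff_left)
next
  assume perp: "\<forall>p. w p = p \<longrightarrow> form x p = 0"
  obtain n where n: "0 < n" "w ^^ n = id" using W_finite_order[OF w] by blast
  define z where "z = (\<Sum>k<n. (w ^^ k) x)"
  have "w z = (\<Sum>k<n. (w ^^ Suc k) x)" using w by (simp add: z_def W_sum)
  \<comment> \<open>Since \<open>w ^^ n = id\<close>, shifting the exponent permutes the summands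
    cyclically.\<close>
  also have "\<dots> = z"
    using sum.lessThan_Suc_shift[of "\<lambda>k. (w ^^ k) x" n] n by (simp add: z_def add.commute)
  finally have wz: "w z = z" .
  have "form ((w ^^ k) x) z = 0" for k
  proof (induction k)
    case (Suc k)
    then show ?case using form_W[OF w, of "(w ^^ k) x" z] wz by simp
  qed (use perp wz in simp)
  then have "form z z = 0" by (subst (1) z_def) (simp add: form_sum_left)
  then have z0: "z = 0" by (simp add: form_eq_zero_iff)
  have zero: "0 \<in> moved_space w" using w by (auto simp: moved_space_def W_zero intro!: image_eqI[of _ _ 0])
  \<comment> \<open>The difference telescopes into consecutive differences, each of which is moved
    by definition.\<close>
  have moved: "(w ^^ k) x - x \<in> moved_space w" for k
  proof (induction k)
    case (Suc k)
    have "w ((w ^^ k) x) - (w ^^ k) x \<in> moved_space w" by (auto simp: moved_space_def)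
    from moved_space_add[OF w this Suc] show ?case by simp
  qed (simp add: zero)
  have "(\<Sum>k<m. (w ^^ k) x - x) \<in> moved_space w" for m
    by (induction m) (auto simp: zero moved intro: moved_space_add[OF w])
  \<comment> \<open>As \<open>z\<close> is zero, this vector is -n x, and the factor -1/n recovers
    \<open>x\<close>.\<close>
  then have "z - scale (of_nat n) x \<in> moved_space w"
    by (simp add: z_def sum_subtractf sum_constant_scale)
  from moved_space_scale[OF w this, of "- 1 / of_nat n"] show "x \<in> moved_space w"
    using n by (simp add: z0)
qed

text \<open>Perturb \<open>p\<close> by a multiple of a fixed vector while the number of roots orthogonal to \<open>p\<close> drops.\<close>

lemma generic_fixed_vector:
  assumes w: "w \<in> W"
  shows "\<exists>p. w p = p \<and> (\<forall>\<beta>\<in>\<Phi>. form \<beta> p = 0 \<longrightarrow> (\<forall>q. w q = q \<longrightarrow> form \<beta> q = 0))"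
proof -
  define Z where "Z p = {\<beta> \<in> \<Phi>. form \<beta> p = 0}" for p
  have finZ: "finite (Z p)" for p using finite_roots by (simp add: Z_def)
  have "w 0 = 0" using w by (rule W_zero)
  then obtain p where p: "w p = p" and min: "\<And>q. w q = q \<Longrightarrow> card (Z p) \<le> card (Z q)"
    using ex_has_least_nat[of "\<lambda>p. w p = p" 0 "\<lambda>p. card (Z p)"] by auto
  have "form \<beta> q = 0" if \<beta>: "\<beta> \<in> \<Phi>" "form \<beta> p = 0" and q: "w q = q" for \<beta> q
  proof (rule ccontr)
    assume nz: "form \<beta> q \<noteq> 0"
    \<comment> \<open>The fractions are the multiples of \<open>q\<close> that would make a new root
      orthogonal; \<open>c \<noteq> 0\<close> ensures that \<open>\<beta>\<close> ceases to be so. A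
      zero denominator yields only the value 0, excluded anyway.\<close>
    have "finite (insert 0 ((\<lambda>\<gamma>. - form \<gamma> p / form \<gamma> q) ` \<Phi>))" using finite_roots by simp
    then obtain c where c: "c \<notin> insert 0 ((\<lambda>\<gamma>. - form \<gamma> p / form \<gamma> q) ` \<Phi>)"
      using ex_new_if_finite[OF infinite_UNIV_char_0] by blast
    define p' where "p' = p + scale c q"
    have form_p': "form \<gamma> p' = form \<gamma> p + c * form \<gamma> q" for \<gamma>
      by (simp add: p'_def form_add_right form_scale_right)
    have "\<gamma> \<in> Z p" if "\<gamma> \<in> Z p'" for \<gamma>
    proof (rule ccontr)
      assume "\<gamma> \<notin> Z p"
      with that have \<gamma>: "\<gamma> \<in> \<Phi>" "form \<gamma> p \<noteq> 0" and sum0: "form \<gamma> p + c * form \<gamma> q = 0"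
        by (auto simp: Z_def form_p')
      then have "form \<gamma> q \<noteq> 0" by auto
      then have "c = - form \<gamma> p / form \<gamma> q" using sum0 by (simp add: field_simps eq_neg_iff_add_eq_0 add.commute)
      then show False using c \<gamma> by blast
    qed
    moreover have "\<beta> \<in> Z p" "\<beta> \<notin> Z p'" using \<beta> nz c by (auto simp: Z_def form_p')
    ultimately have "Z p' \<subset> Z p" by blast
    then have "card (Z p') < card (Z p)" using finZ psubset_card_mono by blast
    moreover have "w p' = p'" using p q w by (simp add: p'_def W_add W_scale)
    ultimately show False using min leD by blast
  qed
  then show ?thesis using p by blast
qed

lemma parabolic_closure:
  assumes w: "w \<in> W"
  shows "\<exists>J\<subseteq>I. \<exists>x\<in>W. roots_of \<Phi> w = x ` root_subsystem scale \<Phi> J \<and>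
    inv x \<circ> w \<circ> x \<in> reflection_group scale \<Phi> J"
proof -
  obtain p where wp: "w p = p" and
    generic: "\<And>\<beta> q. \<beta> \<in> \<Phi> \<Longrightarrow> form \<beta> p = 0 \<Longrightarrow> w q = q \<Longrightarrow> form \<beta> q = 0"
    using generic_fixed_vector[OF w] by blast
  obtain z where z: "z \<in> W" and dom: "\<And>\<alpha>. \<alpha> \<in> I \<Longrightarrow> 0 \<le> form \<alpha> (z p)"
    using dominant_conjugate by blast
  define J where "J = {\<alpha> \<in> I. form \<alpha> (z p) = 0}"
  \<comment> \<open>One inclusion holds because \<open>p\<close> is fixed, the other because it is
    generic.\<close>
  have roots: "roots_of \<Phi> w = {\<beta> \<in> \<Phi>. form \<beta> p = 0}"
    using wp generic by (auto simp: roots_of_def moved_space_eq_fixed_perp[OF w])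
  have sub: "root_subsystem scale \<Phi> J = {\<beta> \<in> \<Phi>. form \<beta> (z p) = 0}"
    using form_dominant_eq_zero_iff[OF dom] by (auto simp: root_subsystem_def J_def)
  have form_z: "form (inv z \<beta>) p = form \<beta> (z p)" for \<beta>
    using form_W[OF z, of "inv z \<beta>" p] z by simp
  have "roots_of \<Phi> w = inv z ` root_subsystem scale \<Phi> J"
  proof
    show "roots_of \<Phi> w \<subseteq> inv z ` root_subsystem scale \<Phi> J"
    proof
      fix \<beta> assume "\<beta> \<in> roots_of \<Phi> w"
      then have "z \<beta> \<in> root_subsystem scale \<Phi> J"
        using z W_root form_W[OF z] by (simp add: roots sub)
      then show "\<beta> \<in> inv z ` root_subsystem scale \<Phi> J"
        using z by (intro image_eqI[of _ _ "z \<beta>"]) simp_all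
    qed
    show "inv z ` root_subsystem scale \<Phi> J \<subseteq> roots_of \<Phi> w"
      using z W_root[OF inv_W[OF z]] by (auto simp: roots sub form_z)
  qed
  moreover have "inv (inv z) \<circ> w \<circ> inv z \<in> reflection_group scale \<Phi> J"
    unfolding J_def by (rule dominant_stabilizer) (use dom w wp z in \<open>simp_all add: W_inv_inv\<close>)
  moreover have "J \<subseteq> I" by (auto simp: J_def)
  ultimately show ?thesis using inv_W[OF z] by blast
qed

section \<open>Conjugation into a prescribed parabolic and decompositions\<close>

lemma conjugate_reflection_group:
  assumes c: "c \<in> W" and "S \<subseteq> \<Phi>"
    and gen: "\<And>\<alpha>. \<alpha> \<in> S \<Longrightarrow> s (c \<alpha>) \<in> reflection_group scale \<Phi> T"
    and x: "x \<in> reflection_group scale \<Phi> S"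
  shows "c \<circ> x \<circ> inv c \<in> reflection_group scale \<Phi> T"
  using x
proof (induction rule: reflection_group.induct)
  case one
  have "c \<circ> id \<circ> inv c = id" using c by simp
  then have "c \<circ> id \<circ> inv c \<in> reflection_group scale \<Phi> T" by (simp only: reflection_group.one)
  then show ?case .
next
  case (incl \<alpha>)
  then have "s (c \<alpha>) \<circ> c \<circ> inv c = c \<circ> s \<alpha> \<circ> inv c" using refl_image_comp[OF c] assms(2) by auto
  then have "c \<circ> s \<alpha> \<circ> inv c = s (c \<alpha>)" using c by (simp add: comp_assoc)
  then have "c \<circ> s \<alpha> \<circ> inv c \<in> reflection_group scale \<Phi> T" by (simp only: gen[OF incl])
  then show ?case .
next
  case (mult x y)
  have "c \<circ> (x \<circ> y) \<circ> inv c = (c \<circ> x \<circ> inv c) \<circ> (c \<circ> y \<circ> inv c)"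
    using c by (simp add: fun_eq_iff)
  then have "c \<circ> (x \<circ> y) \<circ> inv c \<in> reflection_group scale \<Phi> T"
    by (simp only: reflection_group.mult[OF mult.IH])
  then show ?case .
next
  case (inverse x)
  then have "x \<in> W" using reflection_group_mono[OF assms(2)] by blast
  then have "c \<circ> inv x \<circ> inv c = inv (c \<circ> x \<circ> inv c)"
    using c by (simp add: W_inv_of_comp W_inv_inv comp_assoc)
  then have "c \<circ> inv x \<circ> inv c \<in> reflection_group scale \<Phi> T"
    by (simp only: reflection_group.inverse[OF inverse.IH])
  then show ?case .
qed

text \<open>Here \<open>J\<close> and \<open>u\<close> are given, while
  \<open>parabolic_closure\<close> supplies its own \<open>K\<close> and \<open>x\<close>. Both
  describe the same roots, so \<open>c\<close> = u^-1 x carries \<Phi>_K into \<Phi>_J and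
  conjugates W_K into W_J.\<close>

lemma conjugate_mem_parabolic:
  assumes w: "w \<in> W" and J: "J \<subseteq> I" and u: "u \<in> W"
    and roots: "roots_of \<Phi> w = u ` root_subsystem scale \<Phi> J"
  shows "inv u \<circ> w \<circ> u \<in> reflection_group scale \<Phi> J"
proof -
  obtain K x where K: "K \<subseteq> I" and x: "x \<in> W"
    and roots': "roots_of \<Phi> w = x ` root_subsystem scale \<Phi> K"
    and mem: "inv x \<circ> w \<circ> x \<in> reflection_group scale \<Phi> K"
    using parabolic_closure[OF w] by blast
  define c where "c = inv u \<circ> x"
  have c: "c \<in> W" using u x by (simp add: c_def)
  have "s (c \<alpha>) \<in> reflection_group scale \<Phi> J" if "\<alpha> \<in> K" for \<alpha>
  proof -
    have "\<alpha> \<in> root_subsystem scale \<Phi> K"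
      using that K simple_roots by (auto simp: root_subsystem_def span_base)
    then have "x \<alpha> \<in> u ` root_subsystem scale \<Phi> J" using roots roots' by blast
    then have "c \<alpha> \<in> root_subsystem scale \<Phi> J" using u by (auto simp: c_def)
    then show ?thesis using refl_mem_parabolic[OF J] by (simp add: root_subsystem_def)
  qed
  then have "c \<circ> (inv x \<circ> w \<circ> x) \<circ> inv c \<in> reflection_group scale \<Phi> J"
    using conjugate_reflection_group[OF c _ _ mem] K simple_roots by blast
  moreover have "c \<circ> (inv x \<circ> w \<circ> x) \<circ> inv c = inv u \<circ> w \<circ> u"
    using u x by (simp add: c_def fun_eq_iff W_inv_of_comp W_inv_inv)
  ultimately show ?thesis by simp
qed

text \<open>The choice of \<open>v\<close> comes from the coset w2^-1 u W_J: inverting w2^-1 u = v y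
  yields \<open>w2\<close>, and w1 = (w1 w2^-1) w2 then inserts the factor z = u^-1 (w1 w2^-1) u
  from W_J.\<close>

lemma decomposition_exists:
  assumes W: "w1 \<in> W" "w2 \<in> W" and J: "J \<subseteq> I" and u: "u \<in> min_coset_reps scale \<Phi> I J"
    and roots: "roots_of \<Phi> (w1 \<circ> inv w2) = u ` root_subsystem scale \<Phi> J"
  shows "\<exists>v\<in>min_coset_reps scale \<Phi> I J. \<exists>y1\<in>reflection_group scale \<Phi> J. \<exists>y2\<in>reflection_group scale \<Phi> J.
    w1 = u \<circ> y1 \<circ> inv v \<and> w2 = u \<circ> y2 \<circ> inv v"
proof -
  let ?WJ = "reflection_group scale \<Phi> J"
  have uW: "u \<in> W" using u by (simp add: min_coset_reps_def)
  obtain v y where v: "v \<in> min_coset_reps scale \<Phi> I J" and y: "y \<in> ?WJ" and eq: "inv w2 \<circ> u = v \<circ> y"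
    using min_coset_rep_exists[OF J, of "inv w2 \<circ> u"] W uW by auto
  have vW: "v \<in> W" and yW: "y \<in> W" using v y parabolic_subset[OF J] by (auto simp: min_coset_reps_def)
  define z where "z = inv u \<circ> (w1 \<circ> inv w2) \<circ> u"
  have z: "z \<in> ?WJ" unfolding z_def by (rule conjugate_mem_parabolic) (use W J uW roots in simp_all)
  have "inv (inv w2 \<circ> u) = inv (v \<circ> y)" by (simp only: eq)
  then have "inv u \<circ> w2 = inv y \<circ> inv v" using W uW vW yW by (simp add: W_inv_of_comp W_inv_inv)
  then have "u \<circ> (inv u \<circ> w2) = u \<circ> (inv y \<circ> inv v)" by (simp only:)
  then have w2: "w2 = u \<circ> inv y \<circ> inv v" using uW by (simp add: fun_eq_iff)
  have "w1 = u \<circ> z \<circ> inv u \<circ> w2" using W uW by (simp add: z_def fun_eq_iff)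
  also have "\<dots> = u \<circ> (z \<circ> inv y) \<circ> inv v" using uW by (subst w2) (simp add: fun_eq_iff)
  finally have "w1 = u \<circ> (z \<circ> inv y) \<circ> inv v" .
  moreover have "inv y \<in> ?WJ" using y by (rule reflection_group.inverse)
  moreover have "z \<circ> inv y \<in> ?WJ" using z calculation(2) by (rule reflection_group.mult)
  ultimately show ?thesis using v w2 by blast
qed

text \<open>Conjugating by \<open>u\<close> turns w1 w2^-1 into an element of W_J, which moves
  vectors only within the span of \<open>J\<close>; this gives one inclusion. The hypothesis with
  \<open>x\<close> makes both finite sets as large as \<Phi>_J, hence equal.\<close>

lemma decomposition_roots:
  assumes J: "J \<subseteq> I" and x: "x \<in> W"
    and roots: "roots_of \<Phi> (w1 \<circ> inv w2) = x ` root_subsystem scale \<Phi> J"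
    and u: "u \<in> W" and v: "v \<in> W"
    and y: "y1 \<in> reflection_group scale \<Phi> J" "y2 \<in> reflection_group scale \<Phi> J"
    and w: "w1 = u \<circ> y1 \<circ> inv v" "w2 = u \<circ> y2 \<circ> inv v"
  shows "roots_of \<Phi> (w1 \<circ> inv w2) = u ` root_subsystem scale \<Phi> J"
proof (rule card_subset_eq)
  let ?R = "root_subsystem scale \<Phi> J"
  have fin: "finite ?R" using finite_roots by (simp add: root_subsystem_def)
  then show "finite (u ` ?R)" by simp
  have card: "card (z ` ?R) = card ?R" if "z \<in> W" for z
    using that by (intro card_image) (meson W_bij bij_is_inj inj_on_subset subset_UNIV)
  show "card (roots_of \<Phi> (w1 \<circ> inv w2)) = card (u ` ?R)" using card u x by (simp add: roots)
  have yW: "y1 \<in> W" "y2 \<in> W" using y parabolic_subset[OF J] by auto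
  define z where "z = y1 \<circ> inv y2"
  have z: "z \<in> reflection_group scale \<Phi> J"
    unfolding z_def using y by (intro reflection_group.mult reflection_group.inverse)
  have w_eq: "(w1 \<circ> inv w2) a = u (z (inv u a))" for a
    using u v yW by (simp add: w z_def W_inv_of_comp W_inv_inv)
  show "roots_of \<Phi> (w1 \<circ> inv w2) \<subseteq> u ` ?R"
  proof
    fix \<beta> assume "\<beta> \<in> roots_of \<Phi> (w1 \<circ> inv w2)"
    then obtain a where \<beta>: "\<beta> \<in> \<Phi>" "\<beta> = u (z (inv u a)) - a"
      unfolding roots_of_def moved_space_def by (auto simp only: w_eq)
    then have "inv u \<beta> = z (inv u a) - inv u a" using u by (simp add: W_diff)
    then have "inv u \<beta> \<in> span J"
      using J coeff_parabolic[OF J z] by (simp add: span_subset_simple_iff coeff_diff)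
    then have "inv u \<beta> \<in> ?R" using \<beta> u W_root[of "inv u" \<beta>] by (simp add: root_subsystem_def)
    then show "\<beta> \<in> u ` ?R" using u by (intro image_eqI[of _ _ "inv u \<beta>"]) simp_all
  qed
qed

end

theorem proposition1p3:
  fixes scale :: "rat \<Rightarrow> 'v::ab_group_add \<Rightarrow> 'v"
    and \<Phi> I :: "'v set"
    and w1 w2 :: "'v \<Rightarrow> 'v"
  assumes "based_root_system scale \<Phi> I"
    and "w1 \<in> weyl_group scale \<Phi>"
    and "w2 \<in> weyl_group scale \<Phi>"
  shows
    "(\<exists>J\<subseteq>I. \<exists>x\<in>weyl_group scale \<Phi>. roots_of \<Phi> (w1 \<circ> inv w2) = x ` root_subsystem scale \<Phi> J) \<and>
     (\<forall>J\<subseteq>I. (\<exists>x\<in>weyl_group scale \<Phi>. roots_of \<Phi> (w1 \<circ> inv w2) = x ` root_subsystem scale \<Phi> J) \<longrightarrow>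
        (\<exists>u\<in>min_coset_reps scale \<Phi> I J. \<exists>v\<in>min_coset_reps scale \<Phi> I J.
         \<exists>y1\<in>reflection_group scale \<Phi> J. \<exists>y2\<in>reflection_group scale \<Phi> J.
           w1 = u \<circ> y1 \<circ> inv v \<and> w2 = u \<circ> y2 \<circ> inv v) \<and>
        (\<forall>u\<in>min_coset_reps scale \<Phi> I J. \<forall>v\<in>min_coset_reps scale \<Phi> I J.
         \<forall>y1\<in>reflection_group scale \<Phi> J. \<forall>y2\<in>reflection_group scale \<Phi> J.
           w1 = u \<circ> y1 \<circ> inv v \<and> w2 = u \<circ> y2 \<circ> inv v \<longrightarrow>
           (bruhat_le scale \<Phi> I y1 y2 \<longleftrightarrow> good_pair scale \<Phi> I w1 w2)) \<and>
        (\<forall>u\<in>min_coset_reps scale \<Phi> I J.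
           roots_of \<Phi> (w1 \<circ> inv w2) = u ` root_subsystem scale \<Phi> J \<longrightarrow>
           (\<exists>v\<in>min_coset_reps scale \<Phi> I J.
            \<exists>y1\<in>reflection_group scale \<Phi> J. \<exists>y2\<in>reflection_group scale \<Phi> J.
              w1 = u \<circ> y1 \<circ> inv v \<and> w2 = u \<circ> y2 \<circ> inv v)))"
proof -
  interpret based_root_system scale \<Phi> I by (rule assms(1))
  have W: "w1 \<in> W" "w2 \<in> W" "w1 \<circ> inv w2 \<in> W" using assms by simp_all
  \<comment> \<open>Writing x = u y with \<open>y\<close> in W_J, the factor \<open>y\<close>
    permutes \<Phi>_J, so \<open>u\<close> alone has the same image.\<close>
  have some_rep: "\<exists>u\<in>min_coset_reps scale \<Phi> I J. roots_of \<Phi> (w1 \<circ> inv w2) = u ` root_subsystem scale \<Phi> J"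
    if J: "J \<subseteq> I" and x: "x \<in> W" and roots: "roots_of \<Phi> (w1 \<circ> inv w2) = x ` root_subsystem scale \<Phi> J"
    for J x
  proof -
    obtain u y where u: "u \<in> min_coset_reps scale \<Phi> I J" and y: "y \<in> reflection_group scale \<Phi> J"
      and x_eq: "x = u \<circ> y" using min_coset_rep_exists[OF J x] by blast
    have yW: "y \<in> W" using y parabolic_subset[OF J] by blast
    have "y ` root_subsystem scale \<Phi> J = root_subsystem scale \<Phi> J"
    proof (rule card_subset_eq)
      show "finite (root_subsystem scale \<Phi> J)" using finite_roots by (simp add: root_subsystem_def)
      show "y ` root_subsystem scale \<Phi> J \<subseteq> root_subsystem scale \<Phi> J"
        using span_parabolic[OF J y] W_root[OF yW] by (auto simp: root_subsystem_def)
      show "card (y ` root_subsystem scale \<Phi> J) = card (root_subsystem scale \<Phi> J)"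
        using yW by (intro card_image) (meson W_bij bij_is_inj inj_on_subset subset_UNIV)
    qed
    then show ?thesis using roots u by (metis image_comp x_eq)
  qed
  \<comment> \<open>The element \<open>x\<close> need not be related to the decomposition; only
    after it is replaced by \<open>u\<close> do the roots allowed in a good pair become those of the
    translated chains.\<close>
  have equivalence: "bruhat_le scale \<Phi> I y1 y2 \<longleftrightarrow> good_pair scale \<Phi> I w1 w2"
    if J: "J \<subseteq> I" and x: "x \<in> W" and roots: "roots_of \<Phi> (w1 \<circ> inv w2) = x ` root_subsystem scale \<Phi> J"
      and u: "u \<in> min_coset_reps scale \<Phi> I J" and v: "v \<in> min_coset_reps scale \<Phi> I J"
      and y: "y1 \<in> reflection_group scale \<Phi> J" "y2 \<in> reflection_group scale \<Phi> J"
      and w: "w1 = u \<circ> y1 \<circ> inv v" "w2 = u \<circ> y2 \<circ> inv v" for J x u v y1 y2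
  proof -
    have "u \<in> W" "v \<in> W" using u v by (simp_all add: min_coset_reps_def)
    then have "roots_of \<Phi> (w1 \<circ> inv w2) = u ` root_subsystem scale \<Phi> J"
      using decomposition_roots[OF J x roots _ _ y w] by blast
    then have "good_pair scale \<Phi> I w1 w2 \<longleftrightarrow> (refl_step (u ` root_subsystem scale \<Phi> J))\<^sup>*\<^sup>* w1 w2"
      using good_pair_iff[OF W(1,2)] by simp
    then show ?thesis
      using refl_steps_translate_iff[OF J u v y] bruhat_le_parabolic_iff[OF J y] w by simp
  qed
  have exists: "\<exists>J\<subseteq>I. \<exists>x\<in>W. roots_of \<Phi> (w1 \<circ> inv w2) = x ` root_subsystem scale \<Phi> J"
    using parabolic_closure[OF W(3)] by metis
  show ?thesis
  proof (intro conjI allI impI ballI)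
    fix J
    assume J: "J \<subseteq> I" and "\<exists>x\<in>W. roots_of \<Phi> (w1 \<circ> inv w2) = x ` root_subsystem scale \<Phi> J"
    then obtain u where "u \<in> min_coset_reps scale \<Phi> I J"
      "roots_of \<Phi> (w1 \<circ> inv w2) = u ` root_subsystem scale \<Phi> J"
      using some_rep by metis
    then show "\<exists>u\<in>min_coset_reps scale \<Phi> I J. \<exists>v\<in>min_coset_reps scale \<Phi> I J.
        \<exists>y1\<in>reflection_group scale \<Phi> J. \<exists>y2\<in>reflection_group scale \<Phi> J.
          w1 = u \<circ> y1 \<circ> inv v \<and> w2 = u \<circ> y2 \<circ> inv v"
      using decomposition_exists[OF W(1,2) J] by metis
  next
    fix J u v y1 y2
    assume "J \<subseteq> I" "\<exists>x\<in>W. roots_of \<Phi> (w1 \<circ> inv w2) = x ` root_subsystem scale \<Phi> J"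
      "u \<in> min_coset_reps scale \<Phi> I J" "v \<in> min_coset_reps scale \<Phi> I J"
      "y1 \<in> reflection_group scale \<Phi> J" "y2 \<in> reflection_group scale \<Phi> J"
      "w1 = u \<circ> y1 \<circ> inv v \<and> w2 = u \<circ> y2 \<circ> inv v"
    then show "bruhat_le scale \<Phi> I y1 y2 \<longleftrightarrow> good_pair scale \<Phi> I w1 w2"
      using equivalence by metis
  qed (use exists decomposition_exists[OF W(1,2)] in \<open>assumption | metis\<close>)+
qed

end
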